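(* Let $n$ be a prime with $n\equiv 7\pmod 8$, let $Q$ and $N$ be the sets of nonzero quadratic residues and nonresidues modulo $n$, $f_Q(X)=\sum_{i\in Q}X^i$, $f_N(X)=\sum_{i\in N}X^i$. Fix a primitive $n$-th root of unity $\xi$ in an algebraic closure of $\mathbb Q_2$, let $s=1+2\sum_{j\in Q}\xi^j\in\mathbb Z_{2^\infty}$ (so $s^2=-n$), and let $$e_1(X)=\tfrac{n+1}{2n}+\tfrac{1+s}{2n}f_Q(X)+\tfrac{1-s}{2n}f_N(X)\in\mathcal R=\mathbb Z_{2^\infty}[X]/(X^n-1),$$ the idempotent generator of the ideal of $\mathcal R$ generated by $\prod_{j\in Q}(X-\xi^j)$. Let $t\in\mathbb Z_{2^\infty}$ with $t^2=-1/n$, and let $D\subseteq\mathbb Z_{2^\infty}^{n+1}$ be the $\mathbb Z_{2^\infty}$-span of the vectors $(c^{(i)},t)$, $i=0,\dots,n-1$, where $c^{(i)}$ is the coefficient vector of $X^ie_1(X)$ in $\mathcal R$ (the self-dual extended quadratic residue code of length $n+1$ and type $1^{(n+1)/2}$). Then $D$ has minimal Hamming distance $(n+3)/2$, and $D$ is an MDS code.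
   Context: $\mathbb Z_{2^\infty}$ denotes the ring of 2-adic integers and $\mathbb Q_2$ the field of 2-adic numbers. The minimal Hamming distance of a $\mathbb Z_{2^\infty}$-submodule $D\subseteq\mathbb Z_{2^\infty}^{m}$ is the least number of nonzero coordinates of a nonzero element of $D$. If $D$ has (after permuting coordinates) a generator matrix $[\,I_k\ \ A\,]$, it satisfies the Singleton bound $d\le m-k+1$, and $D$ is called MDS (maximal distance separable) if equality holds, equivalently if every $k$ columns of a generator matrix are linearly independent over $\mathbb Z_{2^\infty}$. Here $m=n+1$ and $k=(n+1)/2$. *)

theory Defs
  imports
    "HOL-Computational_Algebra.Polynomial_Factorial"
    "HOL-Number_Theory.Residues"
    "HOL-Algebra.Algebraic_Closure_Type"
    "HOL-Combinatorics.Permutations"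
    "Jordan_Normal_Form.VS_Connect"
begin

text \<open>The inverse limit of the rings of integers modulo \<open>2 ^ k\<close>: the value at \<open>k\<close> is the
  representative of the residue modulo \<open>2 ^ k\<close> in the interval from \<open>0\<close> to \<open>2 ^ k - 1\<close>.\<close>

typedef z2adic =
  "{x :: nat \<Rightarrow> int. (\<forall>k. 0 \<le> x k \<and> x k < 2 ^ k) \<and> (\<forall>k. x (Suc k) mod 2 ^ k = x k)}"
  morphisms residue Abs_z2adic
  by (rule exI[of _ "\<lambda>_. 0"]) simp

setup_lifting type_definition_z2adic

lemma mod_pow_Suc: "(a :: int) mod 2 ^ Suc k mod 2 ^ k = a mod 2 ^ k"
  by (rule mod_mod_cancel) (rule le_imp_power_dvd, simp)

lemma residue_mod: "residue x k mod 2 ^ k = residue x k"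
  using residue[of x] by simp

lemma residue_Suc: "residue x (Suc k) mod 2 ^ k = residue x k"
  using residue[of x] by simp

lemma residue_mod_le: "j \<le> k \<Longrightarrow> residue x k mod 2 ^ j = residue x j"
proof (induction k rule: dec_induct)
  case base
  show ?case by (rule residue_mod)
next
  case (step k)
  have "residue x (Suc k) mod 2 ^ j = residue x (Suc k) mod 2 ^ k mod 2 ^ j"
    using step.hyps by (simp add: mod_mod_cancel le_imp_power_dvd)
  then show ?case
    by (simp add: residue_Suc step.IH)
qed

lemma coherent_mod:
  fixes f :: "nat \<Rightarrow> int"
  assumes "\<And>k. f (Suc k) mod 2 ^ k = f k mod 2 ^ k"
  shows "(\<forall>k. 0 \<le> f k mod 2 ^ k \<and> f k mod 2 ^ k < 2 ^ k) \<and>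
    (\<forall>k. f (Suc k) mod 2 ^ Suc k mod 2 ^ k = f k mod 2 ^ k)"
  unfolding mod_pow_Suc using assms by simp

instantiation z2adic :: comm_ring_1
begin

lift_definition zero_z2adic :: z2adic is "\<lambda>_. 0" by simp

lift_definition one_z2adic :: z2adic is "\<lambda>k. 1 mod 2 ^ k"
  by (rule coherent_mod) (rule refl)

lift_definition plus_z2adic :: "z2adic \<Rightarrow> z2adic \<Rightarrow> z2adic"
  is "\<lambda>x y k. (x k + y k) mod 2 ^ k"
  by (rule coherent_mod) (metis mod_add_eq)

lift_definition uminus_z2adic :: "z2adic \<Rightarrow> z2adic"
  is "\<lambda>x k. (- x k) mod 2 ^ k"
  by (rule coherent_mod) (metis mod_minus_eq)

lift_definition minus_z2adic :: "z2adic \<Rightarrow> z2adic \<Rightarrow> z2adic"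
  is "\<lambda>x y k. (x k - y k) mod 2 ^ k"
  by (rule coherent_mod) (metis mod_diff_eq)

lift_definition times_z2adic :: "z2adic \<Rightarrow> z2adic \<Rightarrow> z2adic"
  is "\<lambda>x y k. (x k * y k) mod 2 ^ k"
  by (rule coherent_mod) (metis mod_mult_eq)

lemmas residue_simps =
  zero_z2adic.rep_eq one_z2adic.rep_eq plus_z2adic.rep_eq uminus_z2adic.rep_eq
  minus_z2adic.rep_eq times_z2adic.rep_eq

lemma z2adic_eqI: "(\<And>k. residue x k = residue y k) \<Longrightarrow> x = y"
  by (metis residue_inject ext)

instance
proof
  fix a b c :: z2adic
  show "a + b + c = a + (b + c)"
    by (rule z2adic_eqI) (simp add: residue_simps mod_simps add.assoc)
  show "a + b = b + a"
    by (rule z2adic_eqI) (simp add: residue_simps add.commute)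
  show "0 + a = a"
    by (rule z2adic_eqI) (simp add: residue_simps residue_mod)
  show "- a + a = 0"
    by (rule z2adic_eqI) (simp add: residue_simps mod_simps)
  show "a - b = a + - b"
    by (rule z2adic_eqI) (simp add: residue_simps mod_simps)
  show "a * b * c = a * (b * c)"
    by (rule z2adic_eqI) (simp add: residue_simps mod_simps mult.assoc)
  show "a * b = b * a"
    by (rule z2adic_eqI) (simp add: residue_simps mult.commute)
  show "1 * a = a"
    by (rule z2adic_eqI) (simp add: residue_simps mod_simps residue_mod del: one_mod_2_pow_eq)
  show "(a + b) * c = a * c + b * c"
    by (rule z2adic_eqI) (simp add: residue_simps mod_simps distrib_right)
  have "residue 0 1 \<noteq> residue 1 1"
    by (simp add: residue_simps)
  then show "(0 :: z2adic) \<noteq> 1" by metis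
qed

end

instance z2adic :: idom
proof
  fix x y :: z2adic
  assume "x \<noteq> 0" "y \<noteq> 0"
  then obtain a b where "residue x a \<noteq> residue 0 a" and "residue y b \<noteq> residue 0 b"
    by (meson z2adic_eqI)
  then have a: "residue x a \<noteq> 0" and b: "residue y b \<noteq> 0"
    by (simp_all add: residue_simps)
  let ?X = "residue x (a + b)" and ?Y = "residue y (a + b)"
  have X: "\<not> 2 ^ a dvd ?X" and Y: "\<not> 2 ^ b dvd ?Y"
    using a b residue_mod_le[of a "a + b" x] residue_mod_le[of b "a + b" y]
    by (auto simp: dvd_eq_mod_eq_0)
  then have nz: "?X \<noteq> 0" "?Y \<noteq> 0" by auto
  have pe: "prime_elem (2 :: int)" by simp
  have "multiplicity 2 ?X < a" "multiplicity 2 ?Y < b"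
    using X Y by (meson multiplicity_dvd' not_le)+
  then have "multiplicity 2 (?X * ?Y) < a + b"
    by (simp add: prime_elem_multiplicity_mult_distrib[OF pe nz])
  then have "\<not> 2 ^ (a + b) dvd ?X * ?Y"
    using nz multiplicity_geI[of "?X * ?Y" 2 "a + b"] by fastforce
  then have "residue (x * y) (a + b) \<noteq> residue 0 (a + b)"
    by (simp add: residue_simps dvd_eq_mod_eq_0)
  then show "x * y \<noteq> 0" by metis
qed

lemma residue_of_nat: "residue (of_nat m) k = int m mod 2 ^ k"
proof (induction m)
  case (Suc m)
  have "residue (of_nat (Suc m)) k = (1 mod 2 ^ k + residue (of_nat m) k) mod 2 ^ k"
    by (simp add: residue_simps)
  then show ?case by (simp add: Suc mod_simps add.commute del: one_mod_2_pow_eq)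
qed (simp add: residue_simps)

instance z2adic :: ring_char_0
proof
  show "inj (of_nat :: nat \<Rightarrow> z2adic)"
  proof (rule injI)
    fix m n :: nat
    assume eq: "(of_nat m :: z2adic) = of_nat n"
    have "(2 :: int) ^ (m + n) = int (2 ^ (m + n))" by simp
    then have lt: "int m < 2 ^ (m + n)" "int n < 2 ^ (m + n)"
      using less_exp[of "m + n"] by linarith+
    show "m = n"
      using arg_cong[OF eq, of "\<lambda>x. residue x (m + n)"] lt by (simp add: residue_of_nat)
  qed
qed

type_synonym q2adic = "z2adic fract"

definition quad_residues :: "nat \<Rightarrow> nat set" where
  "quad_residues n = {i \<in> {1..<n}. QuadRes (int n) (int i)}"

definition quad_nonresidues :: "nat \<Rightarrow> nat set" where
  "quad_nonresidues n = {i \<in> {1..<n}. \<not> QuadRes (int n) (int i)}"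


definition code_span :: "nat \<Rightarrow> 'a :: comm_ring_1 vec set \<Rightarrow> 'a vec set" where
  "code_span m S = LinearCombinations.module.span class_ring (module_vec TYPE('a) m) S"

definition hamming_weight :: "'a :: zero vec \<Rightarrow> nat" where
  "hamming_weight v = card {i. i < dim_vec v \<and> v $ i \<noteq> 0}"

definition min_distance :: "'a :: zero vec set \<Rightarrow> nat" where
  "min_distance D = (LEAST d. \<exists>v\<in>D. v \<noteq> 0\<^sub>v (dim_vec v) \<and> hamming_weight v = d)"

definition permute_coords :: "(nat \<Rightarrow> nat) \<Rightarrow> 'a vec \<Rightarrow> 'a vec" where
  "permute_coords \<pi> v = vec (dim_vec v) (\<lambda>j. v $ \<pi> j)"

text \<open>The matrix whose rows are spanned below is the block matrix with blocks the identity
  and \<open>A\<close>, side by side.\<close>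

definition has_standard_generator :: "nat \<Rightarrow> nat \<Rightarrow> 'a :: comm_ring_1 vec set \<Rightarrow> bool" where
  "has_standard_generator m k D \<longleftrightarrow> k \<le> m \<and> D \<subseteq> carrier_vec m \<and>
     (\<exists>\<pi> A. \<pi> permutes {..<m} \<and> A \<in> carrier_mat k (m - k) \<and>
        permute_coords \<pi> ` D =
          code_span m (set (rows (mat_of_cols k (cols (1\<^sub>m k) @ cols A)))))"

text \<open>The bound \<open>1 \<le> k\<close> excludes the zero code, which has no minimal distance.\<close>

definition is_MDS :: "nat \<Rightarrow> nat \<Rightarrow> 'a :: comm_ring_1 vec set \<Rightarrow> bool" where
  "is_MDS m k D \<longleftrightarrow>
     1 \<le> k \<and> has_standard_generator m k D \<and> min_distance D = m - k + 1"

text \<open>The coefficient vector, of length \<open>n\<close>, of the class of \<open>p\<close> modulo \<open>X ^ n - 1\<close>. As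
  \<open>X ^ n - 1\<close> is monic, the pseudo-remainder is the remainder of the division with remainder,
  which is available over any commutative ring for a monic divisor.\<close>

definition cyclic_coeffs :: "nat \<Rightarrow> 'a :: idom poly \<Rightarrow> 'a vec" where
  "cyclic_coeffs n p = vec n (Polynomial.coeff (pseudo_mod p (Polynomial.monom 1 n - 1)))"

lemma cyclic_coeffs_correct:
  fixes p :: "'a :: idom poly"
  assumes "0 < n"
  shows "Polynomial.monom 1 n - 1 dvd p - (\<Sum>j<n. Polynomial.monom (cyclic_coeffs n p $ j) j)"
proof -
  let ?g = "Polynomial.monom 1 n - 1 :: 'a poly"
  let ?r = "pseudo_mod p ?g"
  have coeff_n: "Polynomial.coeff ?g n = 1" using assms by simp
  have deg: "Polynomial.degree ?g = n"
  proof (rule antisym)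
    show "Polynomial.degree ?g \<le> n"
      by (rule degree_diff_le) (simp_all add: degree_monom_le)
    show "n \<le> Polynomial.degree ?g"
      using assms by (intro le_degree) (simp add: coeff_n)
  qed
  have nz: "?g \<noteq> 0" using coeff_n by force
  obtain q r where qr: "pseudo_divmod p ?g = (q, r)" by (cases "pseudo_divmod p ?g")
  have r: "r = ?r" by (simp add: pseudo_mod_def qr)
  have p: "p = ?g * q + ?r"
    using pseudo_divmod(1)[OF nz qr] by (simp only: deg coeff_n power_one smult_1_left r)
  have "Polynomial.degree ?r < n"
    using pseudo_mod(2)[OF nz, of p] assms by (auto simp: deg)
  then have "(\<Sum>j<n. Polynomial.monom (cyclic_coeffs n p $ j) j) = ?r"
    by (intro poly_eqI) (auto simp: coeff_sum cyclic_coeffs_def coeff_eq_0)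
  then show ?thesis using p by (metis add_diff_cancel_right' dvd_triv_left)
qed

end

theory Submission
  imports Defs "HOL-Number_Theory.Euler_Criterion"
begin

text \<open>By Chebotarev's theorem, no minor of the Fourier matrix of prime order \<open>n\<close> vanishes in
  characteristic \<open>0\<close>, so a nonzero word vanishing at \<open>r\<close> of the powers of \<open>\<xi>\<close> has at least
  \<open>r + 1\<close> nonzero coordinates. The Gauss sum identity \<open>s\<^sup>2 = -n\<close> gives \<open>e\<^sub>1(\<xi> ^ j) = 0\<close> for residues
  \<open>j\<close> and \<open>1\<close> otherwise, so \<open>D\<close> consists of the words \<open>(c, t c(1))\<close> with \<open>c\<close> vanishing at
  \<open>\<xi> ^ j\<close> for the \<open>(n - 1) / 2\<close> residues \<open>j\<close>. If \<open>c(1) = 0\<close> there is one more zero; otherwise the last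
  coordinate is nonzero; both cases give weight at least \<open>(n + 3) / 2\<close>. The polynomial
  \<open>g = \<Prod>(X - \<xi> ^ j)\<close> over the residues has 2-adic integer coefficients, as these are
  integral combinations of \<open>1\<close> and \<open>(s \<plusminus> 1) / 2\<close>, and division by the monic \<open>g\<close> yields a
  systematic basis, whose vectors attain the bound.\<close>

no_notation fps_nth (infixl \<open>$\<close> 75)

section \<open>Integers in \<open>p \<int>[\<xi>]\<close>\<close>

lemma cong_det:
  fixes A B :: "int mat"
  assumes "A \<in> carrier_mat n n" "B \<in> carrier_mat n n"
    and "\<And>i j. i < n \<Longrightarrow> j < n \<Longrightarrow> [A $$ (i,j) = B $$ (i,j)] (mod m)"
  shows "[det A = det B] (mod m)"
  unfolding det_def'[OF assms(1)] det_def'[OF assms(2)]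
  by (intro cong_sum cong_mult cong_prod cong_refl assms(3)) (auto simp: permutes_in_image)

text \<open>The middle binomial coefficients are divisible by \<open>p\<close>. The remainder is
  kept as an explicit multiple of \<open>p\<close> because the identity is later evaluated at
  \<open>\<xi>\<close> in characteristic \<open>0\<close>.\<close>

lemma prime_power_add:
  fixes x y :: "'a :: comm_ring_1"
  assumes p: "Factorial_Ring.prime p"
  shows "\<exists>z. (x + y) ^ p = x ^ p + y ^ p + of_nat p * z"
proof -
  have p2: "2 \<le> p" using p by (rule prime_ge_2_nat)
  let ?f = "\<lambda>k. of_nat (p choose k) * x ^ k * y ^ (p - k)"
  have "(x + y) ^ p = (\<Sum>k\<le>p. ?f k)" by (rule binomial_ring)
  also have "{..p} = insert 0 (insert p {0<..<p})" using p2 by auto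
  also have "(\<Sum>k\<in>insert 0 (insert p {0<..<p}). ?f k) = y ^ p + x ^ p + (\<Sum>k\<in>{0<..<p}. ?f k)"
    using p2 by (simp add: add.assoc)
  also have "(\<Sum>k\<in>{0<..<p}. ?f k)
      = (\<Sum>k\<in>{0<..<p}. of_nat p * (of_nat ((p choose k) div p) * x ^ k * y ^ (p - k)))"
  proof (rule sum.cong)
    fix k assume k: "k \<in> {0<..<p}"
    have "p dvd (p choose k)" by (rule dvd_choose_prime) (use k p in auto)
    then have "of_nat (p choose k) = (of_nat p * of_nat ((p choose k) div p) :: 'a)"
      by (metis dvd_mult_div_cancel of_nat_mult)
    then show "?f k = of_nat p * (of_nat ((p choose k) div p) * x ^ k * y ^ (p - k))"
      by (simp add: mult.assoc)
  qed simp
  finally show ?thesis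
    by (intro exI[of _ "\<Sum>k\<in>{0<..<p}. of_nat ((p choose k) div p) * x ^ k * y ^ (p - k)"])
      (simp add: sum_distrib_left add_ac)
qed

lemma eval_poly_hom:
  assumes "comm_ring_hom h"
  shows "comm_ring_hom (\<lambda>P. poly (map_poly h P) x)"
proof -
  interpret comm_ring_hom h by fact
  have "map_poly h (P + R) = map_poly h P + map_poly h R"
    and "map_poly h (P * R) = map_poly h P * map_poly h R" for P R
    by (simp_all add: poly_eq_iff coeff_map_poly coeff_mult hom_distribs)
  then show ?thesis by unfold_locales (simp_all add: map_poly_1')
qed

text \<open>The circulant matrix of \<open>a + p S(X)\<close> modulo \<open>X ^ p - 1\<close> kills the vector of powers of \<open>\<xi>\<close>,
  so its determinant vanishes, while modulo \<open>p\<close> it is \<open>a\<close> times the identity.\<close>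

lemma prime_dvd_of_multiple_in_Z_xi:
  fixes \<xi> :: "'a :: field_char_0"
  assumes p: "Factorial_Ring.prime p" and xi: "\<xi> ^ p = 1"
    and a: "of_int a + of_nat p * poly (map_poly of_int S) \<xi> = 0"
  shows "int p dvd a"
proof -
  have p0: "0 < p" using p by (rule prime_gt_0_nat)
  \<comment> \<open>\<open>w b c\<close> is the coefficient of \<open>X ^ c\<close> in
    \<open>X ^ b * S\<close> reduced modulo \<open>X ^ p - 1\<close>.\<close>
  define w where "w b c = (\<Sum>m\<in>{m\<in>{..degree S}. (b + m) mod p = c}. coeff S m)" for b c
  define M where "M = mat p p (\<lambda>(b, c). (if b = c then a else 0) + int p * w b c)"
  have M: "M \<in> carrier_mat p p" by (simp add: M_def)
  define u where "u = vec p (\<lambda>c. \<xi> ^ c)"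
  have xi_mod: "\<xi> ^ (m mod p) = \<xi> ^ m" for m
    by (metis xi mult.left_neutral power_add power_mult power_one div_mult_mod_eq mult.commute)
  have S_xi: "poly (map_poly of_int S) \<xi> = (\<Sum>m\<le>degree S. of_int (coeff S m) * \<xi> ^ m)"
    by (simp add: poly_altdef degree_map_poly coeff_map_poly)
  have w_xi: "(\<Sum>c<p. of_int (w b c) * \<xi> ^ c) = \<xi> ^ b * poly (map_poly of_int S) \<xi>" for b
  proof -
    have "(\<Sum>c<p. of_int (w b c) * \<xi> ^ c)
        = (\<Sum>c<p. \<Sum>m\<in>{m\<in>{..degree S}. (b + m) mod p = c}. of_int (coeff S m) * \<xi> ^ ((b + m) mod p))"
      unfolding w_def of_int_sum sum_distrib_right by (intro sum.cong) auto
    also have "\<dots> = (\<Sum>m\<le>degree S. of_int (coeff S m) * \<xi> ^ ((b + m) mod p))"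
      by (rule sum.group) (use p0 in auto)
    finally show ?thesis unfolding xi_mod S_xi sum_distrib_left
      by (simp add: power_add mult_ac)
  qed
  have "map_mat of_int M *\<^sub>v u = 0\<^sub>v p"
  proof (rule eq_vecI)
    fix b assume b: "b < dim_vec (0\<^sub>v p :: 'a vec)"
    then have b: "b < p" by simp
    have "(map_mat of_int M *\<^sub>v u) $ b = (\<Sum>c<p. of_int (M $$ (b, c)) * \<xi> ^ c)"
      using b by (simp add: M_def u_def scalar_prod_def lessThan_atLeast0)
    also have "\<dots>
        = (\<Sum>c<p. (if b = c then of_int a * \<xi> ^ c else 0) + of_nat p * (of_int (w b c) * \<xi> ^ c))"
      using b by (intro sum.cong) (auto simp: M_def algebra_simps)
    also have "\<dots> = \<xi> ^ b * (of_int a + of_nat p * poly (map_poly of_int S) \<xi>)"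
      unfolding sum.distrib sum_distrib_left[symmetric] w_xi sum.delta'[OF finite_lessThan]
      using b by (simp add: distrib_left mult_ac)
    finally show "(map_mat of_int M *\<^sub>v u) $ b = 0\<^sub>v p $ b" using a b by simp
  qed (simp add: M_def)
  moreover have "u \<in> carrier_vec p" by (simp add: u_def)
  moreover have "u \<noteq> 0\<^sub>v p"
  proof
    assume "u = 0\<^sub>v p"
    then have "u $ 0 = 0" using p0 by simp
    then show False using p0 by (simp add: u_def)
  qed
  ultimately have "det (map_mat of_int M :: 'a mat) = 0"
    using det_0_iff_vec_prod_zero[of "map_mat of_int M :: 'a mat" p] M by auto
  \<comment> \<open>The integers embed injectively in characteristic \<open>0\<close>, so the
    determinant already vanishes over the integers.\<close>
  then have "det M = 0" by simp
  moreover have "[det M = det (a \<cdot>\<^sub>m 1\<^sub>m p)] (mod int p)"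
    by (rule cong_det[OF M]) (auto simp: M_def cong_def)
  ultimately have "int p dvd a ^ p"
    by (simp add: cong_def dvd_eq_mod_eq_0)
  then show ?thesis
    using p prime_dvd_power by (metis prime_nat_int_transfer)
qed

text \<open>Modulo \<open>p\<close> and \<open>X ^ p - 1\<close>, the \<open>p\<close>-th power of \<open>R\<close> is the constant \<open>R(1) ^ p\<close>; this
  replaces the irreducibility of the cyclotomic polynomial.\<close>

lemma prime_dvd_poly_1_of_root_of_unity_root:
  fixes \<xi> :: "'a :: field_char_0"
  assumes p: "Factorial_Ring.prime p" and odd: "odd p" and xi: "\<xi> ^ p = 1"
    and R: "poly (map_poly of_int R) \<xi> = 0"
  shows "int p dvd poly R 1"
proof -
  define c where "c = poly R 1"
  interpret ev: comm_ring_hom "\<lambda>P. poly (map_poly of_int P) \<xi>" by (rule eval_poly_hom) unfold_locales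
  have "[:-1, 1:] dvd R - [:c:]"
    using poly_eq_0_iff_dvd[of "R - [:c:]" 1] by (simp add: c_def)
  \<comment> \<open>\<open>X - 1\<close> is written as a sum so that \<open>prime_power_add\<close>
    applies to it as well.\<close>
  then obtain T where T: "R = [:c:] + ([:0, 1:] + [:-1:]) * T"
    by (auto simp: dvd_def algebra_simps)
  obtain z1 where z1: "R ^ p = [:c:] ^ p + (([:0, 1:] + [:-1:]) * T) ^ p + of_nat p * z1"
    using prime_power_add[OF p] T by metis
  obtain z2 where z2: "([:0, 1:] + [:-1:]) ^ p = [:0, 1:] ^ p + [:-1:] ^ p + of_nat p * (z2 :: int poly)"
    using prime_power_add[OF p] by metis
  have "0 = poly (map_poly of_int (R ^ p)) \<xi>"
    using R prime_gt_0_nat[OF p] by (simp add: ev.hom_power)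
  \<comment> \<open>At \<open>\<xi>\<close> the term \<open>X ^ p + (-1) ^ p\<close> vanishes, since
    \<open>\<xi> ^ p = 1\<close> and \<open>p\<close> is odd; only \<open>c ^ p\<close> and
    multiples of \<open>p\<close> remain.\<close>
  also have "\<dots> = of_int (c ^ p) + of_nat p * poly (map_poly of_int (z2 * T ^ p + z1)) \<xi>"
    unfolding z1 power_mult_distrib z2 ev.hom_power ev.hom_add ev.hom_mult
    using odd xi by (simp add: map_poly_pCons ev.hom_of_nat algebra_simps)
  finally have "int p dvd c ^ p"
    using prime_dvd_of_multiple_in_Z_xi[OF p xi, of "c ^ p"] by simp
  then show ?thesis
    using p prime_dvd_power unfolding c_def by (metis prime_nat_int_transfer)
qed

section \<open>Chebotarev's theorem on Fourier minors\<close>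

text \<open>Expanding the polynomials in powers multiplies the Vandermonde matrix by an upper
  triangular matrix with ones on the diagonal. This serves both for Newton products and for falling
  factorials.\<close>

lemma det_monic_eval_eq:
  fixes P :: "nat \<Rightarrow> 'a :: comm_ring_1 poly"
  assumes deg: "\<And>l. degree (P l) = l" and monic: "\<And>l. lead_coeff (P l) = 1"
  shows "det (mat k k (\<lambda>(a, l). poly (P l) (x a))) = det (mat k k (\<lambda>(a, m). x a ^ m))"
proof -
  let ?V = "mat k k (\<lambda>(a, m). x a ^ m)" and ?C = "mat k k (\<lambda>(m, l). coeff (P l) m)"
  have "mat k k (\<lambda>(a, l). poly (P l) (x a)) = ?V * ?C"
  proof (rule eq_matI)
    fix a l assume "a < dim_row (?V * ?C)" "l < dim_col (?V * ?C)"
    then have al: "a < k" "l < k" by auto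
    have "poly (P l) (x a) = (\<Sum>m\<le>l. coeff (P l) m * x a ^ m)"
      by (simp add: poly_altdef deg)
    also have "\<dots> = (\<Sum>m<k. coeff (P l) m * x a ^ m)"
      by (rule sum.mono_neutral_left) (use al deg in \<open>auto simp: coeff_eq_0\<close>)
    finally show "mat k k (\<lambda>(a, l). poly (P l) (x a)) $$ (a, l) = (?V * ?C) $$ (a, l)"
      using al by (simp add: scalar_prod_def lessThan_atLeast0 mult.commute)
  qed auto
  moreover have "det (?V * ?C) = det ?V * det ?C"
    by (rule det_mult) auto
  moreover have "det ?C = prod_list (diag_mat ?C)"
    by (rule det_upper_triangular[of _ k]) (auto simp: upper_triangular_def deg coeff_eq_0)
  moreover have "diag_mat ?C = map (\<lambda>_. 1) [0..<k]"
    using deg monic by (auto simp: diag_mat_def)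
  ultimately show ?thesis by (simp add: map_replicate_const prod_list_replicate)
qed

text \<open>In the Newton basis \<open>N\<close> the matrix is lower triangular, since
  \<open>N l\<close> vanishes at \<open>x a\<close> for \<open>a < l\<close>.\<close>

lemma vandermonde_det:
  fixes x :: "nat \<Rightarrow> 'a :: idom"
  shows "det (mat k k (\<lambda>(a, m). x a ^ m)) = (\<Prod>a<k. \<Prod>b<a. x a - x b)"
proof -
  define N where "N l = (\<Prod>b<l. [:- x b, 1:])" for l
  let ?N = "mat k k (\<lambda>(a, l). poly (N l) (x a))"
  have "det ?N = det (mat k k (\<lambda>(a, m). x a ^ m))"
  proof (rule det_monic_eval_eq)
    show "degree (N l) = l" for l
      unfolding N_def by (subst degree_prod_sum_eq) auto
    show "lead_coeff (N l) = 1" for l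
      unfolding N_def lead_coeff_prod by simp
  qed
  moreover have "det ?N = prod_list (diag_mat ?N)"
    by (rule det_lower_triangular[of k]) (auto simp: N_def poly_prod)
  moreover have "prod_list (diag_mat ?N) = (\<Prod>a<k. poly (N a) (x a))"
    by (simp add: diag_mat_def prod.list_conv_set_nth lessThan_atLeast0)
  ultimately show ?thesis by (simp add: N_def poly_prod)
qed

text \<open>Scaling column \<open>l\<close> by \<open>fact l\<close> turns the binomial coefficients
  into falling factorials, which are monic polynomials in \<open>i a\<close>. The scaled determinant
  is therefore a Vandermonde product, whose factors are nonzero and of absolute value less than
  \<open>p\<close>.\<close>

lemma prime_not_dvd_det_binomial:
  fixes i :: "nat \<Rightarrow> nat"
  assumes p: "Factorial_Ring.prime p" and i: "\<And>a. a < k \<Longrightarrow> i a < p" and inj: "inj_on i {..<k}"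
  shows "\<not> int p dvd det (mat k k (\<lambda>(a, l). int (i a choose l)))"
proof
  let ?B = "mat k k (\<lambda>(a, l). int (i a choose l))"
  let ?F = "mat k k (\<lambda>(m, l). if m = l then fact l else 0 :: int)"
  assume dvd: "int p dvd det ?B"
  define P where "P l = (\<Prod>b<l. [:- int b, 1:])" for l
  have P: "poly (P l) (int m) = fact l * int (m choose l)" for l m
  proof (induction l)
    case (Suc l)
    have "(int m - int l) * int (m choose l) = int (Suc l) * int (m choose Suc l)"
    proof (cases "l \<le> m")
      case True
      have "Suc l * (m choose Suc l) = (m - l) * (m choose l)"
        using binomial_absorb_comp[of m l] binomial_absorption[of l m] by simp
      then have "int (Suc l) * int (m choose Suc l) = int (m - l) * int (m choose l)"
        unfolding of_nat_mult[symmetric] by (rule arg_cong)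
      with True show ?thesis by (simp add: of_nat_diff)
    qed (simp add: binomial_eq_0)
    moreover have "poly (P (Suc l)) (int m) = fact l * ((int m - int l) * int (m choose l))"
      using Suc by (simp add: P_def algebra_simps)
    ultimately show ?case by (simp add: algebra_simps)
  qed (simp add: P_def)
  have "det (mat k k (\<lambda>(a, l). poly (P l) (int (i a)))) = det (mat k k (\<lambda>(a, m). int (i a) ^ m))"
  proof (rule det_monic_eval_eq)
    show "degree (P l) = l" for l
      unfolding P_def by (subst degree_prod_sum_eq) auto
    show "lead_coeff (P l) = 1" for l
      unfolding P_def lead_coeff_prod by simp
  qed
  moreover have "mat k k (\<lambda>(a, l). poly (P l) (int (i a))) = ?B * ?F"
    by (rule eq_matI)
      (auto simp: P scalar_prod_def mult.commute if_distrib[of "\<lambda>z. _ * z"] sum.delta cong: if_cong)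
  moreover have "det (?B * ?F) = det ?B * det ?F"
    by (rule det_mult) auto
  ultimately have "(\<Prod>a<k. \<Prod>b<a. int (i a) - int (i b)) = det ?B * det ?F"
    unfolding vandermonde_det by argo
  then have "int p dvd (\<Prod>a<k. \<Prod>b<a. int (i a) - int (i b))"
    using dvd by simp
  moreover have pi: "Factorial_Ring.prime (int p)" using p by simp
  ultimately obtain a b where ab: "a < k" "b < a" and d: "int p dvd int (i a) - int (i b)"
    by (auto simp: prime_dvd_prod_iff)
  have "i a \<noteq> i b" using inj ab by (auto dest!: inj_onD[of _ _ a b])
  moreover have "i a < p" "i b < p" using i ab by auto
  ultimately show False using d zdvd_imp_le[OF _ , of "int p" "\<bar>int (i a) - int (i b)\<bar>"] by auto
qed

text \<open>Coefficients of \<open>z ^ i\<close> in the Newton basis with nodes \<open>y\<close>. Over the integer polynomials with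
  nodes \<open>X ^ j\<^sub>b\<close> they specialise to the Fourier minor at \<open>X = \<xi>\<close> and to binomial coefficients at
  \<open>X = 1\<close>.\<close>

fun newton_coeff :: "(nat \<Rightarrow> 'a :: comm_ring_1) \<Rightarrow> nat \<Rightarrow> nat \<Rightarrow> 'a" where
  "newton_coeff y 0 0 = 1"
| "newton_coeff y 0 (Suc l) = 0"
| "newton_coeff y (Suc i) 0 = y 0 * newton_coeff y i 0"
| "newton_coeff y (Suc i) (Suc l) = newton_coeff y i l + y (Suc l) * newton_coeff y i (Suc l)"

lemma newton_coeff_eq_0: "i < l \<Longrightarrow> newton_coeff y i l = 0"
  by (induction y i l rule: newton_coeff.induct) auto

text \<open>With all nodes equal to \<open>1\<close> the recursion is Pascal's rule.\<close>

lemma newton_coeff_one: "newton_coeff (\<lambda>_. 1) i l = of_nat (i choose l)"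
  by (induction "\<lambda>_ :: nat. 1 :: 'a" i l rule: newton_coeff.induct) auto

lemma (in comm_ring_hom) hom_newton_coeff:
  "hom (newton_coeff y i l) = newton_coeff (\<lambda>b. hom (y b)) i l"
  by (induction y i l rule: newton_coeff.induct) (auto simp: hom_distribs)

text \<open>The Newton products satisfy \<open>z * N l = N (l + 1) + y l * N l\<close>, which is the
  recursion of \<open>newton_coeff\<close>. The bound \<open>L\<close> gives all powers up to it a
  common summation range.\<close>

lemma newton_expansion:
  assumes "i \<le> L"
  shows "z ^ i = (\<Sum>l\<le>L. newton_coeff y i l * (\<Prod>b<l. z - y b))"
  using assms
proof (induction i)
  case 0
  have "(\<Sum>l\<le>L. newton_coeff y 0 l * (\<Prod>b<l. z - y b)) = (\<Sum>l\<le>L. if l = 0 then 1 else 0)"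
    by (rule sum.cong) (auto simp: newton_coeff_eq_0)
  then show ?case by simp
next
  case (Suc i)
  then obtain L' where L: "L = Suc L'" "i \<le> L'" by (cases L) auto
  let ?N = "\<lambda>l. \<Prod>b<l. z - y b"
  have "z ^ Suc i = (\<Sum>l\<le>L. newton_coeff y i l * (z * ?N l))"
    using Suc by (simp add: sum_distrib_left mult_ac)
  also have "\<dots> = (\<Sum>l\<le>L. newton_coeff y i l * ?N (Suc l)) + (\<Sum>l\<le>L. y l * newton_coeff y i l * ?N l)"
    unfolding sum.distrib[symmetric] by (rule sum.cong) (auto simp: algebra_simps)
  also have "(\<Sum>l\<le>L. newton_coeff y i l * ?N (Suc l)) = (\<Sum>l\<le>L'. newton_coeff y i l * ?N (Suc l))"
    using L by (simp add: newton_coeff_eq_0)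
  also have "\<dots> + (\<Sum>l\<le>L. y l * newton_coeff y i l * ?N l)
      = (\<Sum>l\<le>L. newton_coeff y (Suc i) l * ?N l)"
    unfolding L(1) sum.atMost_Suc_shift
    by (simp add: sum.distrib distrib_right add_ac del: prod.lessThan_Suc)
  finally show ?case .
qed

text \<open>The Newton expansion factors the matrix of powers. The second factor is upper
  triangular, because a Newton product with \<open>l > b\<close> vanishes at the node
  \<open>y b\<close>; its diagonal gives the Vandermonde product.\<close>

lemma det_powers_newton:
  fixes y :: "nat \<Rightarrow> 'a :: idom"
  shows "det (mat k k (\<lambda>(a, b). y b ^ i a))
    = det (mat k k (\<lambda>(a, l). newton_coeff y (i a) l)) * (\<Prod>a<k. \<Prod>b<a. y a - y b)"
proof -
  let ?H = "mat k k (\<lambda>(a, l). newton_coeff y (i a) l)"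
  let ?G = "mat k k (\<lambda>(l, b). \<Prod>c<l. y b - y c)"
  have "mat k k (\<lambda>(a, b). y b ^ i a) = ?H * ?G"
  proof (rule eq_matI)
    fix a b assume "a < dim_row (?H * ?G)" "b < dim_col (?H * ?G)"
    then have ab: "a < k" "b < k" by auto
    let ?t = "\<lambda>l. newton_coeff y (i a) l * (\<Prod>c<l. y b - y c)"
    \<comment> \<open>The range up to \<open>max (i a) k\<close> covers both the exponent and all
      \<open>k\<close> columns of the first factor; the terms with \<open>l \<ge> k\<close> contain
      the factor \<open>y b - y b\<close> and drop out.\<close>
    have "y b ^ i a = (\<Sum>l\<le>max (i a) k. ?t l)"
      by (rule newton_expansion) simp
    also have "\<dots> = (\<Sum>l<k. ?t l)"
      by (rule sum.mono_neutral_right) (use ab in \<open>auto simp: not_less intro!: prod_zero\<close>)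
    finally show "mat k k (\<lambda>(a, b). y b ^ i a) $$ (a, b) = (?H * ?G) $$ (a, b)"
      using ab by (simp add: scalar_prod_def lessThan_atLeast0)
  qed auto
  moreover have "det (?H * ?G) = det ?H * det ?G"
    by (rule det_mult) auto
  moreover have "det ?G = prod_list (diag_mat ?G)"
    by (rule det_upper_triangular[of _ k]) (auto simp: upper_triangular_def)
  moreover have "prod_list (diag_mat ?G) = (\<Prod>a<k. \<Prod>b<a. y a - y b)"
    by (simp add: diag_mat_def prod.list_conv_set_nth lessThan_atLeast0)
  ultimately show ?thesis by simp
qed

section \<open>Nonvanishing Fourier minors and the uncertainty principle\<close>

lemma root_of_unity_power_inj:
  fixes \<xi> :: "'a :: field"
  assumes prim: "\<And>j. 0 < j \<Longrightarrow> j < n \<Longrightarrow> \<xi> ^ j \<noteq> 1" and xi: "\<xi> ^ n = 1" and n: "0 < n"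
    and ab: "a < n" "b < n" and eq: "\<xi> ^ a = \<xi> ^ b"
  shows "a = b"
proof (rule ccontr)
  assume "a \<noteq> b"
  have nz: "\<xi> \<noteq> 0" using xi n by (auto simp: power_0_left)
  have "\<xi> ^ (max a b - min a b) = 1"
    using eq nz by (simp add: power_diff max_def min_def)
  moreover have "0 < max a b - min a b" "max a b - min a b < n" using ab \<open>a \<noteq> b\<close> by auto
  ultimately show False using prim by blast
qed

text \<open>By \<open>det_powers_newton\<close> the minor is a Vandermonde product of distinct
  powers of \<open>\<xi>\<close> times the value at \<open>\<xi>\<close> of an integer polynomial.
  The value of that polynomial at \<open>1\<close> is a binomial determinant, which \<open>p\<close>
  does not divide, so it cannot vanish at \<open>\<xi>\<close>.\<close>

theorem chebotarev_minor:
  fixes \<xi> :: "'a :: field_char_0"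
  assumes p: "Factorial_Ring.prime p" and odd: "odd p" and xi: "\<xi> ^ p = 1"
    and prim: "\<And>j. 0 < j \<Longrightarrow> j < p \<Longrightarrow> \<xi> ^ j \<noteq> 1"
    and i: "\<And>a. a < k \<Longrightarrow> i a < p" "inj_on i {..<k}"
    and j: "\<And>a. a < k \<Longrightarrow> j a < p" "inj_on j {..<k}"
  shows "det (mat k k (\<lambda>(a, b). \<xi> ^ (j b * i a))) \<noteq> 0"
proof -
  have p0: "0 < p" using p by (rule prime_gt_0_nat)
  interpret ev: comm_ring_hom "\<lambda>P. poly (map_poly of_int P) \<xi>" by (rule eval_poly_hom) unfold_locales
  interpret ev1: comm_ring_hom "\<lambda>P :: int poly. poly P 1" by unfold_locales auto
  let ?H = "mat k k (\<lambda>(a, l). newton_coeff (\<lambda>b. monom (1 :: int) (j b)) (i a) l)"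
  have "det (mat k k (\<lambda>(a, l). newton_coeff (\<lambda>b. \<xi> ^ j b) (i a) l))
      = det (map_mat (\<lambda>P. poly (map_poly of_int P) \<xi>) ?H)"
    by (rule arg_cong[where f = det], rule eq_matI)
      (auto simp: ev.hom_newton_coeff map_poly_monom poly_monom)
  also have "\<dots> = poly (map_poly of_int (det ?H)) \<xi>" by (rule ev.hom_det)
  finally have H: "det (mat k k (\<lambda>(a, l). newton_coeff (\<lambda>b. \<xi> ^ j b) (i a) l))
      = poly (map_poly of_int (det ?H)) \<xi>" .
  have "poly (det ?H) 1 = det (map_mat (\<lambda>P. poly P 1) ?H)" by (rule ev1.hom_det[symmetric])
  also have "map_mat (\<lambda>P. poly P 1) ?H = mat k k (\<lambda>(a, l). int (i a choose l))"
    by (rule eq_matI) (auto simp: ev1.hom_newton_coeff poly_monom newton_coeff_one)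
  finally have "\<not> int p dvd poly (det ?H) 1"
    using prime_not_dvd_det_binomial[OF p i] by simp
  then have "poly (map_poly of_int (det ?H)) \<xi> \<noteq> 0"
    using prime_dvd_poly_1_of_root_of_unity_root[OF p odd xi] by blast
  moreover have "(\<Prod>a<k. \<Prod>b<a. \<xi> ^ j a - \<xi> ^ j b) \<noteq> 0"
  proof -
    have "\<xi> ^ j a \<noteq> \<xi> ^ j b" if "a < k" "b < a" for a b
    proof
      assume "\<xi> ^ j a = \<xi> ^ j b"
      then have "j a = j b" using that j(1) by (intro root_of_unity_power_inj[OF prim xi p0]) auto
      then show False using j(2) that by (auto dest: inj_onD[of _ _ a b])
    qed
    then show ?thesis by auto
  qed
  ultimately show ?thesis
    unfolding power_mult det_powers_newton H by simp
qed

text \<open>If \<open>c\<close> were nonzero with support of size \<open>k\<close>, then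
  \<open>k\<close> of the zeros in \<open>J\<close> and the support would index a square Fourier
  minor with the nonzero kernel vector \<open>c\<close>, contradicting
  \<open>chebotarev_minor\<close>.\<close>

lemma uncertainty_principle:
  fixes \<xi> :: "'a :: field_char_0" and c :: "nat \<Rightarrow> 'a"
  assumes p: "Factorial_Ring.prime p" and odd: "odd p" and xi: "\<xi> ^ p = 1"
    and prim: "\<And>j. 0 < j \<Longrightarrow> j < p \<Longrightarrow> \<xi> ^ j \<noteq> 1"
    and J: "J \<subseteq> {..<p}" and zero: "\<And>j. j \<in> J \<Longrightarrow> (\<Sum>i<p. c i * \<xi> ^ (i * j)) = 0"
    and le: "card {i. i < p \<and> c i \<noteq> 0} \<le> card J" and m: "m < p"
  shows "c m = 0"
proof (rule ccontr)
  assume cm: "c m \<noteq> 0"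
  let ?I = "{i. i < p \<and> c i \<noteq> 0}"
  define k where "k = card ?I"
  obtain J' where J': "J' \<subseteq> J" "card J' = k" "finite J'"
    using obtain_subset_with_card_n[OF le] unfolding k_def by metis
  obtain i where i: "bij_betw i {..<k} ?I"
    using ex_bij_betw_nat_finite[of ?I] by (auto simp: k_def lessThan_atLeast0)
  obtain j where j: "bij_betw j {..<k} J'"
    using ex_bij_betw_nat_finite[OF J'(3)] J'(2) by (auto simp: lessThan_atLeast0)
  have i_im: "i a < p" "c (i a) \<noteq> 0" if "a < k" for a
    using bij_betwE[OF i] that by auto
  have j_im: "j a < p" "j a \<in> J" if "a < k" for a
    using bij_betwE[OF j] that J' J by auto
  let ?M = "mat k k (\<lambda>(a, b). \<xi> ^ (i b * j a))"
  have "det ?M \<noteq> 0"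
    by (rule chebotarev_minor[OF p odd xi prim])
      (use i_im j_im bij_betw_imp_inj_on[OF i] bij_betw_imp_inj_on[OF j] in auto)
  moreover have "?M *\<^sub>v vec k (c \<circ> i) = 0\<^sub>v k"
  proof (rule eq_vecI)
    fix a assume "a < dim_vec (0\<^sub>v k :: 'a vec)"
    then have a: "a < k" by simp
    have "(?M *\<^sub>v vec k (c \<circ> i)) $ a = (\<Sum>b<k. c (i b) * \<xi> ^ (i b * j a))"
      using a by (simp add: scalar_prod_def lessThan_atLeast0 mult.commute)
    also have "\<dots> = (\<Sum>b\<in>?I. c b * \<xi> ^ (b * j a))"
      using sum.reindex_bij_betw[OF i, of "\<lambda>b. c b * \<xi> ^ (b * j a)"] by simp
    also have "\<dots> = (\<Sum>b<p. c b * \<xi> ^ (b * j a))"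
      by (rule sum.mono_neutral_left) auto
    also have "\<dots> = 0" using zero j_im(2)[OF a] by simp
    finally show "(?M *\<^sub>v vec k (c \<circ> i)) $ a = 0\<^sub>v k $ a" using a by simp
  qed simp
  ultimately have v: "vec k (c \<circ> i) = 0\<^sub>v k"
    using det_0_iff_vec_prod_zero[of ?M k] by (metis mat_carrier vec_carrier)
  have "c (i a) = 0" if "a < k" for a
    using arg_cong[OF v, of "\<lambda>w. w $ a"] that by simp
  moreover have "m \<in> i ` {..<k}"
    using bij_betw_imp_surj_on[OF i] m cm by simp
  ultimately show False using cm by auto
qed

section \<open>Gauss sums and residue-invariant sums\<close>

lemma Legendre_cases: "Legendre a p \<in> {-1, 0, 1}"
  by (auto simp: Legendre_def)

text \<open>The numbers \<open>-1\<close>, \<open>0\<close>, \<open>1\<close> are pairwise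
  incongruent modulo \<open>p > 2\<close>. This upgrades the congruences of Euler's criterion to
  equalities.\<close>

lemma Legendre_eqI:
  assumes "[Legendre a p = x] (mod p)" "x \<in> {-1, 0, 1}" "2 < p"
  shows "Legendre a p = x"
proof -
  have "p dvd Legendre a p - x" using assms(1) by (simp add: cong_iff_dvd_diff)
  moreover have "\<bar>Legendre a p - x\<bar> < p" using assms(2,3) Legendre_cases[of a p] by auto
  ultimately show ?thesis using zdvd_imp_le[of p "\<bar>Legendre a p - x\<bar>"] by fastforce
qed

lemma Legendre_mult:
  assumes p: "Factorial_Ring.prime p" "2 < p"
  shows "Legendre (a * b) (int p) = Legendre a (int p) * Legendre b (int p)"
proof (rule Legendre_eqI)
  let ?h = "(p - 1) div 2"
  have "[Legendre (a * b) p = (a * b) ^ ?h] (mod p)" by (rule euler_criterion[OF p])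
  moreover have "[Legendre a p * Legendre b p = a ^ ?h * b ^ ?h] (mod p)"
    by (intro cong_mult euler_criterion[OF p])
  ultimately show "[Legendre (a * b) p = Legendre a p * Legendre b p] (mod p)"
    unfolding power_mult_distrib by (metis cong_sym cong_trans)
  show "Legendre a p * Legendre b p \<in> {-1, 0, 1}"
    using Legendre_cases[of a p] Legendre_cases[of b p] by auto
qed (use p in simp)

lemma Legendre_cong: "[a = b] (mod p) \<Longrightarrow> Legendre a p = Legendre b p"
  unfolding Legendre_def QuadRes_def cong_def by simp

lemma Legendre_minus_1:
  assumes p: "Factorial_Ring.prime p" "p mod 4 = 3"
  shows "Legendre (-1) (int p) = -1"
proof (rule Legendre_eqI)
  have "2 < p" using p(2) by presburger
  moreover have "odd ((p - 1) div 2)" using p(2) by presburger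
  ultimately show "[Legendre (-1) p = -1] (mod p)"
    using euler_criterion[OF p(1), of "-1"] by simp
  show "2 < int p" using \<open>2 < p\<close> by simp
qed simp

text \<open>The congruence modulo \<open>4\<close> makes \<open>-1\<close> a nonresidue. This fixes
  the sign in \<open>s ^ 2 = -n\<close> and lets \<open>n - 1\<close> represent the
  nonresidues.\<close>

locale qr_root =
  fixes n :: nat and \<xi> :: "'k :: field_char_0"
  assumes prime_n: "Factorial_Ring.prime n" and n_mod_4: "n mod 4 = 3"
    and xi_n: "\<xi> ^ n = 1" and xi_prim: "\<And>j. 0 < j \<Longrightarrow> j < n \<Longrightarrow> \<xi> ^ j \<noteq> 1"
begin

abbreviation \<chi> :: "nat \<Rightarrow> int" where "\<chi> i \<equiv> Legendre (int i) (int n)"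

lemma n_gt_2: "2 < n" using n_mod_4 by presburger

lemma chi_mult: "\<chi> (i * j) = \<chi> i * \<chi> j"
  using Legendre_mult[OF prime_n n_gt_2] by simp

lemma chi_mod: "\<chi> (i mod n) = \<chi> i"
  by (rule Legendre_cong) (simp add: cong_def zmod_int)

lemma chi_eq_0_iff: "\<chi> i = 0 \<longleftrightarrow> n dvd i"
  unfolding Legendre_def by (simp add: cong_0_iff)

lemma chi_1: "\<chi> 1 = 1"
  using chi_mult[of 1 1] chi_eq_0_iff[of 1] n_gt_2 by auto

lemma chi_n_minus_1: "\<chi> (n - 1) = -1"
proof -
  have "\<chi> (n - 1) = Legendre (-1) (int n)"
    using n_gt_2 by (intro Legendre_cong) (simp add: cong_iff_dvd_diff of_nat_diff)
  then show ?thesis using Legendre_minus_1[OF prime_n n_mod_4] by simp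
qed

lemma mem_Q_iff: "i \<in> quad_residues n \<longleftrightarrow> i < n \<and> \<chi> i = 1"
proof (cases "i < n")
  case True
  then show ?thesis using chi_eq_0_iff[of i] n_gt_2
    by (cases "i = 0") (auto simp: quad_residues_def Legendre_def cong_0_iff split: if_splits)
qed (auto simp: quad_residues_def)

lemma mem_N_iff: "i \<in> quad_nonresidues n \<longleftrightarrow> i < n \<and> \<chi> i = -1"
proof (cases "i < n")
  case True
  then show ?thesis using chi_eq_0_iff[of i] n_gt_2
    by (cases "i = 0") (auto simp: quad_nonresidues_def Legendre_def cong_0_iff split: if_splits)
qed (auto simp: quad_nonresidues_def)

lemma finite_Q [simp]: "finite (quad_residues n)"
  and finite_N [simp]: "finite (quad_nonresidues n)"
  by (simp_all add: quad_residues_def quad_nonresidues_def)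

lemma lessThan_n_decomp: "{..<n} = insert 0 (quad_residues n \<union> quad_nonresidues n)"
  and Q_N_disjoint: "quad_residues n \<inter> quad_nonresidues n = {}"
  and zero_notin: "0 \<notin> quad_residues n" "0 \<notin> quad_nonresidues n"
  using n_gt_2 by (auto simp: quad_residues_def quad_nonresidues_def)

lemma sum_decomp:
  "(\<Sum>i<n. f i) = f 0 + (\<Sum>i\<in>quad_residues n. f i) + (\<Sum>i\<in>quad_nonresidues n. f i)"
  for f :: "nat \<Rightarrow> 'b :: comm_ring_1"
  unfolding lessThan_n_decomp using zero_notin Q_N_disjoint
  by (simp add: sum.union_disjoint add.assoc)

lemma bij_mult_mod:
  assumes "\<not> n dvd j"
  shows "bij_betw (\<lambda>i. i * j mod n) {..<n} {..<n}"
proof -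
  have "coprime j n" using prime_imp_coprime_nat[OF prime_n assms] by (simp add: coprime_commute)
  then have "inj_on (\<lambda>i. i * j mod n) {..<n}"
    by (auto simp: inj_on_def cong_mult_rcancel_nat cong_def[symmetric] cong_less_modulus_unique_nat)
  moreover have "(\<lambda>i. i * j mod n) ` {..<n} \<subseteq> {..<n}" using n_gt_2 by auto
  ultimately show ?thesis by (simp add: bij_betw_def endo_inj_surj)
qed

lemma xi_mod: "\<xi> ^ (i mod n) = \<xi> ^ i"
  by (metis xi_n mult.left_neutral power_add power_mult power_one div_mult_mod_eq mult.commute)

lemma xi_eq_1_iff: "\<xi> ^ i = 1 \<longleftrightarrow> n dvd i"
proof -
  have "i mod n < n" using n_gt_2 by simp
  then have "\<xi> ^ (i mod n) = 1 \<longleftrightarrow> i mod n = 0" using xi_prim[of "i mod n"] by fastforce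
  then show ?thesis by (simp add: xi_mod dvd_eq_mod_eq_0)
qed

lemma sum_xi_powers: "(\<Sum>i<n. \<xi> ^ (i * j)) = (if n dvd j then of_nat n else 0)"
proof (cases "n dvd j")
  case True
  then have "\<xi> ^ (i * j) = 1" for i by (simp add: xi_eq_1_iff)
  then show ?thesis using True by simp
next
  case False
  have "(\<xi> ^ j - 1) * (\<Sum>i<n. (\<xi> ^ j) ^ i) = (\<xi> ^ j) ^ n - 1"
    by (simp add: power_diff_1_eq)
  also have "\<dots> = 0" by (metis xi_n power_mult mult.commute power_one diff_self)
  finally have "(\<Sum>i<n. (\<xi> ^ j) ^ i) = 0" using False xi_eq_1_iff by auto
  then show ?thesis using False by (simp add: power_mult[symmetric] mult.commute)
qed

section \<open>The quadratic Gauss sum and the values of the idempotent\<close>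

definition gauss_sum :: "nat \<Rightarrow> 'k" where
  "gauss_sum j = (\<Sum>i<n. of_int (\<chi> i) * \<xi> ^ (i * j))"

lemma gauss_sum_eq:
  "gauss_sum j = (\<Sum>i\<in>quad_residues n. \<xi> ^ (i * j)) - (\<Sum>i\<in>quad_nonresidues n. \<xi> ^ (i * j))"
proof -
  have "\<chi> 0 = 0" by (simp add: Legendre_def)
  then show ?thesis unfolding gauss_sum_def sum_decomp
    by (simp add: mem_Q_iff mem_N_iff sum_negf)
qed

text \<open>Multiplication by \<open>n - 1\<close>, which is \<open>-1\<close> modulo
  \<open>n\<close>, swaps residues and nonresidues.\<close>

lemma card_Q_eq_card_N: "card (quad_residues n) = card (quad_nonresidues n)"
proof -
  define k where "k = n - 1"
  let ?m = "\<lambda>i. i * k mod n"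
  have nd: "\<not> n dvd k" using n_gt_2 by (auto simp: k_def dest: dvd_imp_le)
  have bij: "bij_betw ?m {..<n} {..<n}" by (rule bij_mult_mod[OF nd])
  have chi: "\<chi> (?m i) = - \<chi> i" for i 
    by (simp only: chi_mod chi_mult) (simp only: k_def chi_n_minus_1 mult_minus_right mult_1_right)
  have inj: "inj_on ?m (quad_residues n)" "inj_on ?m (quad_nonresidues n)"
    using bij_betw_imp_inj_on[OF bij] by (rule inj_on_subset; auto simp: mem_Q_iff mem_N_iff)+
  have "card (quad_residues n) \<le> card (quad_nonresidues n)"
    by (rule card_inj_on_le[of ?m])
      (use n_gt_2 inj in \<open>auto simp: mem_Q_iff mem_N_iff chi\<close>)
  moreover have "card (quad_nonresidues n) \<le> card (quad_residues n)"
    by (rule card_inj_on_le[of ?m])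
      (use n_gt_2 inj in \<open>auto simp: mem_Q_iff mem_N_iff chi\<close>)
  ultimately show ?thesis by simp
qed

lemma card_Q: "card (quad_residues n) = (n - 1) div 2"
proof -
  have "n = card {..<n}" by simp
  also have "\<dots> = 1 + (card (quad_residues n) + card (quad_nonresidues n))"
    unfolding lessThan_n_decomp using zero_notin Q_N_disjoint by (simp add: card_Un_disjoint)
  finally show ?thesis using card_Q_eq_card_N by simp
qed

text \<open>Reindexing by \<open>i * j mod n\<close> moves the twist into the character. If
  \<open>n\<close> divides \<open>j\<close>, both sides are \<open>0\<close>, as there are as many
  residues as nonresidues.\<close>

lemma gauss_sum_twist: "gauss_sum j = of_int (\<chi> j) * gauss_sum 1"
proof (cases "n dvd j")
  case True
  then have "\<xi> ^ (i * j) = 1" for i by (simp add: xi_eq_1_iff)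
  then show ?thesis using True card_Q_eq_card_N by (simp add: gauss_sum_eq chi_eq_0_iff[THEN iffD2])
next
  case False
  then have "\<chi> j \<noteq> 0" by (simp add: chi_eq_0_iff)
  then have sq: "\<chi> j * \<chi> j = 1" using Legendre_cases[of "int j" "int n"] by auto
  have "gauss_sum 1 = (\<Sum>i<n. of_int (\<chi> (i * j mod n)) * \<xi> ^ (i * j mod n))"
    using sum.reindex_bij_betw[OF bij_mult_mod[OF False], of "\<lambda>i. of_int (\<chi> i) * \<xi> ^ i"]
    by (simp add: gauss_sum_def)
  also have "\<dots> = (\<Sum>i<n. of_int (\<chi> j) * (of_int (\<chi> i) * \<xi> ^ (i * j)))"
    by (simp only: chi_mod chi_mult xi_mod) (simp add: mult_ac)
  also have "\<dots> = of_int (\<chi> j) * gauss_sum j"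
    by (simp add: gauss_sum_def sum_distrib_left)
  finally have "of_int (\<chi> j) * gauss_sum 1 = of_int (\<chi> j * \<chi> j) * gauss_sum j"
    by (simp add: mult.assoc)
  then show ?thesis unfolding sq by simp
qed

text \<open>Fourier inversion at \<open>1\<close> of the Gauss sum, evaluated in two ways.\<close>

lemma gauss_sum_square: "gauss_sum 1 * gauss_sum 1 = - of_nat n"
proof -
  \<comment> \<open>\<open>k\<close> represents \<open>-1\<close>, so summing
    \<open>\<xi> ^ (j * (i + k))\<close> over \<open>j\<close> singles out
    \<open>i = 1\<close>.\<close>
  define k where "k = n - 1"
  have n: "n = Suc k" "1 < k" using n_gt_2 by (auto simp: k_def)
  have dvd: "n dvd i + k \<longleftrightarrow> i = 1" if "i < n" for i
  proof
    assume "n dvd i + k"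
    then obtain q where q: "i + k = n * q" by (elim dvdE)
    have "n * q < n * 2" using that n unfolding q[symmetric] by simp
    moreover have "0 < n * q" using n unfolding q[symmetric] by simp
    ultimately have "q = 1" by auto
    then show "i = 1" using q n by simp
  qed (use n in simp)
  have "(\<Sum>j<n. gauss_sum j * \<xi> ^ (j * k)) = (\<Sum>i<n. of_int (\<chi> i) * (\<Sum>j<n. \<xi> ^ (j * (i + k))))"
    unfolding gauss_sum_def sum_distrib_left sum_distrib_right
    by (rule trans[OF sum.swap]) (simp add: power_add distrib_left mult_ac)
  also have "\<dots> = (\<Sum>i<n. if i = 1 then of_nat n else 0)"
    using chi_1 by (intro sum.cong) (auto simp: sum_xi_powers dvd)
  also have "\<dots> = of_nat n" using n_gt_2 by simp
  finally have "of_nat n = (\<Sum>j<n. gauss_sum j * \<xi> ^ (j * k))" ..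
  \<comment> \<open>The second evaluation pulls out \<open>gauss_sum 1\<close> by the twist and
    leaves the Gauss sum at \<open>-1\<close>, which is \<open>- gauss_sum 1\<close>.\<close>
  also have "\<dots> = (\<Sum>j<n. gauss_sum 1 * (of_int (\<chi> j) * \<xi> ^ (j * k)))"
    by (subst gauss_sum_twist) (simp add: mult_ac)
  also have "\<dots> = gauss_sum 1 * gauss_sum k"
    by (simp add: gauss_sum_def[of k] sum_distrib_left)
  also have "gauss_sum k = - gauss_sum 1"
    by (subst gauss_sum_twist) (simp only: k_def chi_n_minus_1, simp)
  finally show ?thesis by simp
qed

text \<open>This identifies the Gauss sum with the \<open>s\<close> of the theorem; the nonresidues
  are eliminated by the vanishing sum of all \<open>n\<close>-th roots of unity.\<close>

lemma gauss_sum_1_eq: "gauss_sum 1 = 1 + 2 * (\<Sum>j\<in>quad_residues n. \<xi> ^ j)"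
  and sum_N_eq: "(\<Sum>j\<in>quad_nonresidues n. \<xi> ^ j) = - 1 - (\<Sum>j\<in>quad_residues n. \<xi> ^ j)"
proof -
  have "(\<Sum>i<n. \<xi> ^ (i * 1)) = 0" using sum_xi_powers[of 1] n_gt_2 by simp
  then have "1 + (\<Sum>j\<in>quad_residues n. \<xi> ^ j) + (\<Sum>j\<in>quad_nonresidues n. \<xi> ^ j) = 0"
    by (simp add: sum_decomp)
  then show N: "(\<Sum>j\<in>quad_nonresidues n. \<xi> ^ j) = - 1 - (\<Sum>j\<in>quad_residues n. \<xi> ^ j)"
    by (simp add: eq_neg_iff_add_eq_0 algebra_simps)
  show "gauss_sum 1 = 1 + 2 * (\<Sum>j\<in>quad_residues n. \<xi> ^ j)"
    by (simp add: gauss_sum_eq N)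
qed

text \<open>The left side is \<open>e1\<close> at \<open>\<xi> ^ j\<close>. With \<open>q\<close>
  and \<open>r\<close> the sums over residues and nonresidues, its numerator is
  \<open>n + (1 + q + r) + s * (q - r)\<close>; the bracket is \<open>n\<close> or \<open>0\<close>,
  and the last term is \<open>- n * \<chi> j\<close> by the twist and
  \<open>s ^ 2 = -n\<close>.\<close>

lemma idempotent_eval:
  assumes s: "s = gauss_sum 1"
  shows "(of_nat n + 1) / (2 * of_nat n)
      + (1 + s) / (2 * of_nat n) * (\<Sum>i\<in>quad_residues n. \<xi> ^ (i * j))
      + (1 - s) / (2 * of_nat n) * (\<Sum>i\<in>quad_nonresidues n. \<xi> ^ (i * j))
    = (if n dvd j then 1 else if \<chi> j = 1 then 0 else 1)" (is "?E = _")
proof -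
  let ?q = "\<Sum>i\<in>quad_residues n. \<xi> ^ (i * j)" and ?r = "\<Sum>i\<in>quad_nonresidues n. \<xi> ^ (i * j)"
  have n0: "(of_nat n :: 'k) \<noteq> 0" using n_gt_2 by simp
  have "s * (?q - ?r) = gauss_sum 1 * (of_int (\<chi> j) * gauss_sum 1)"
    by (simp only: s gauss_sum_eq[symmetric] gauss_sum_twist[of j])
  also have "\<dots> = of_int (\<chi> j) * (gauss_sum 1 * gauss_sum 1)" by (rule mult.left_commute)
  finally have "s * (?q - ?r) = - (of_int (\<chi> j) * of_nat n)"
    by (simp only: gauss_sum_square mult_minus_right)
  moreover have "1 + ?q + ?r = (if n dvd j then of_nat n else 0)"
    using sum_xi_powers[of j] by (simp add: sum_decomp)
  moreover have "?E = (of_nat n + (1 + ?q + ?r) + s * (?q - ?r)) / (2 * of_nat n)"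
    using n0 by (simp add: field_simps)
  ultimately have E: "?E = (of_nat n + (if n dvd j then of_nat n else 0) - of_int (\<chi> j) * of_nat n) / (2 * of_nat n)"
    by simp
  show ?thesis unfolding E
    using n0 Legendre_cases[of "int j" "int n"] chi_eq_0_iff[of j] by (auto simp: field_simps)
qed

section \<open>Symmetric functions of the residue powers of \<open>\<xi>\<close>\<close>

text \<open>The residues act transitively by multiplication on each of the two nonzero classes: the
  quotient of \<open>m'\<close> by \<open>m\<close> modulo \<open>n\<close> has character
  \<open>1\<close>, since \<open>\<chi> m\<close> can be cancelled.\<close>

lemma chi_eq_imp_mult:
  assumes "\<chi> m = \<chi> m'" "\<not> n dvd m" "m' < n"
  obtains a where "a < n" "\<chi> a = 1" "m * a mod n = m'"
proof -
  have "m' \<in> (\<lambda>i. i * m mod n) ` {..<n}"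
    using bij_betw_imp_surj_on[OF bij_mult_mod[OF assms(2)]] assms(3) by simp
  then obtain a where a: "a < n" "m' = a * m mod n" by auto
  then have "\<chi> m = \<chi> a * \<chi> m" using assms(1) by (simp only: chi_mod chi_mult)
  then have "\<chi> a = 1" using assms(2) chi_eq_0_iff[of m] by auto
  then show ?thesis using a that by (metis mult.commute)
qed

text \<open>For \<open>m < n\<close> this is the multiplicity of \<open>\<xi> ^ m\<close> in the
  \<open>r\<close>-th elementary symmetric function of the powers \<open>\<xi> ^ j\<close> with
  \<open>j\<close> a residue.\<close>

definition subset_sum_count :: "nat \<Rightarrow> nat \<Rightarrow> nat" where
  "subset_sum_count r m = card {T. T \<subseteq> quad_residues n \<and> card T = r \<and> \<Sum>T mod n = m}"

text \<open>Multiplication by a residue \<open>a\<close> permutes the \<open>r\<close>-element sets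
  of residues and multiplies their sums by \<open>a\<close>. The reverse inequality follows by
  exchanging \<open>m\<close> and \<open>m'\<close>.\<close>

lemma subset_sum_count_le:
  assumes "\<chi> m = \<chi> m'" "\<not> n dvd m" "m' < n"
  shows "subset_sum_count r m \<le> subset_sum_count r m'"
proof -
  obtain a where a: "a < n" "\<chi> a = 1" "m * a mod n = m'"
    using chi_eq_imp_mult[OF assms] .
  have "\<not> n dvd a" using a chi_eq_0_iff[of a] by auto
  let ?f = "\<lambda>i. i * a mod n"
  have inj: "inj_on ?f {..<n}" using bij_mult_mod[OF \<open>\<not> n dvd a\<close>] by (rule bij_betw_imp_inj_on)
  have Q: "quad_residues n \<subseteq> {..<n}" by (auto simp: mem_Q_iff)
  have injT: "inj_on ?f T" if "T \<subseteq> quad_residues n" for T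
    by (rule inj_on_subset[OF inj]) (use that Q in blast)
  have sum: "\<Sum>(?f ` T) mod n = \<Sum>T * a mod n" if T: "T \<subseteq> quad_residues n" for T
  proof -
    have "\<Sum>(?f ` T) = (\<Sum>i\<in>T. ?f i)"
      by (simp add: sum.reindex[OF injT[OF T]])
    then show ?thesis by (simp only: mod_sum_eq sum_distrib_right)
  qed
  show ?thesis unfolding subset_sum_count_def
  proof (rule card_inj_on_le[of "image ?f"])
    show "inj_on (image ?f) {T. T \<subseteq> quad_residues n \<and> card T = r \<and> \<Sum>T mod n = m}"
      by (rule inj_on_subset[OF inj_on_image_Pow[OF inj]]) (use Q in auto)
    show "image ?f ` {T. T \<subseteq> quad_residues n \<and> card T = r \<and> \<Sum>T mod n = m}
        \<subseteq> {T. T \<subseteq> quad_residues n \<and> card T = r \<and> \<Sum>T mod n = m'}"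
    proof (rule image_subsetI, elim CollectE conjE, intro CollectI conjI)
      fix T assume T: "T \<subseteq> quad_residues n" and r: "card T = r" and m: "\<Sum>T mod n = m"
      show "card (?f ` T) = r" using injT[OF T] r by (simp add: card_image)
      show "\<Sum>(?f ` T) mod n = m'"
        using sum[OF T] m a(3) mod_mult_left_eq[of "\<Sum>T" n a] by simp
      show "?f ` T \<subseteq> quad_residues n"
      proof
        fix x assume "x \<in> ?f ` T"
        then obtain i where i: "i \<in> quad_residues n" "x = i * a mod n" using T by blast
        have "\<chi> x = 1" unfolding i(2) chi_mod chi_mult using a i(1) by (simp add: mem_Q_iff)
        then show "x \<in> quad_residues n" using i(2) n_gt_2 by (simp add: mem_Q_iff)
      qed
    qed
    show "finite {T. T \<subseteq> quad_residues n \<and> card T = r \<and> \<Sum>T mod n = m'}"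
      by (rule finite_subset[of _ "Pow (quad_residues n)"]) auto
  qed
qed

lemma subset_sum_count_eq:
  assumes "\<chi> m = \<chi> m'" "m < n" "m' < n" "0 < m" "0 < m'"
  shows "subset_sum_count r m = subset_sum_count r m'"
  by (rule antisym; rule subset_sum_count_le) (use assms in \<open>auto dest: dvd_imp_le\<close>)

text \<open>Grouping the subsets by their sum modulo \<open>n\<close>, the multiplicities are
  constant on each quadratic class, with representatives \<open>1\<close> and \<open>n - 1\<close>.
  This counting takes the place of Galois invariance.\<close>

lemma elementary_symmetric_Q:
  "(\<Sum>T | T \<subseteq> quad_residues n \<and> card T = r. \<xi> ^ \<Sum>T)
    = of_nat (subset_sum_count r 0) + of_nat (subset_sum_count r 1) * (\<Sum>j\<in>quad_residues n. \<xi> ^ j)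
      + of_nat (subset_sum_count r (n - 1)) * (\<Sum>j\<in>quad_nonresidues n. \<xi> ^ j)"
proof -
  let ?S = "{T. T \<subseteq> quad_residues n \<and> card T = r}"
  have fin: "finite ?S" by (rule finite_subset[of _ "Pow (quad_residues n)"]) auto
  have "(\<Sum>T\<in>?S. \<xi> ^ \<Sum>T) = (\<Sum>m<n. \<Sum>T\<in>{T\<in>?S. \<Sum>T mod n = m}. \<xi> ^ \<Sum>T)"
    using fin n_gt_2 by (intro sum.group[symmetric]) auto
  also have "\<dots> = (\<Sum>m<n. of_nat (subset_sum_count r m) * \<xi> ^ m)"
  proof (rule sum.cong[OF refl])
    fix m
    have "(\<Sum>T\<in>{T\<in>?S. \<Sum>T mod n = m}. \<xi> ^ \<Sum>T) = (\<Sum>T\<in>{T\<in>?S. \<Sum>T mod n = m}. \<xi> ^ m)"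
      by (rule sum.cong) (auto simp: xi_mod)
    also have "\<dots> = of_nat (subset_sum_count r m) * \<xi> ^ m"
      by (simp add: subset_sum_count_def conj_assoc)
    finally show "(\<Sum>T\<in>{T\<in>?S. \<Sum>T mod n = m}. \<xi> ^ \<Sum>T) = of_nat (subset_sum_count r m) * \<xi> ^ m" .
  qed
  also have "\<dots> = of_nat (subset_sum_count r 0)
      + (\<Sum>m\<in>quad_residues n. of_nat (subset_sum_count r 1) * \<xi> ^ m)
      + (\<Sum>m\<in>quad_nonresidues n. of_nat (subset_sum_count r (n - 1)) * \<xi> ^ m)"
  proof -
    have "subset_sum_count r m = subset_sum_count r 1" if "m \<in> quad_residues n" for m
      using that n_gt_2 zero_notin
      by (intro subset_sum_count_eq) (auto simp: mem_Q_iff chi_1[simplified] intro!: Nat.gr0I)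
    moreover have "subset_sum_count r m = subset_sum_count r (n - 1)" if m: "m \<in> quad_nonresidues n" for m
    proof (rule subset_sum_count_eq)
      show "\<chi> m = \<chi> (n - 1)" using m by (simp only: mem_N_iff chi_n_minus_1)
      show "0 < m" using m zero_notin by (auto intro!: Nat.gr0I)
    qed (use m n_gt_2 in \<open>auto simp: mem_N_iff\<close>)
    ultimately show ?thesis unfolding sum_decomp by simp
  qed
  finally show ?thesis by (simp add: sum_distrib_left)
qed

text \<open>Vieta's formula: \<open>T\<close> collects the factors that contribute their constant
  term.\<close>

lemma coeff_prod_Q:
  "coeff (\<Prod>j\<in>quad_residues n. [:- (\<xi> ^ j), 1:]) d
    = (\<Sum>T | T \<subseteq> quad_residues n \<and> card (quad_residues n) - card T = d. (-1) ^ card T * \<xi> ^ \<Sum>T)"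
proof -
  let ?Q = "quad_residues n"
  have "(\<Prod>j\<in>?Q. [:- (\<xi> ^ j), 1:]) = (\<Prod>j\<in>?Q. monom 1 1 - [:\<xi> ^ j:])"
    by (simp add: monom_altdef)
  also have "\<dots> = (\<Sum>T\<in>Pow ?Q. (-1) ^ card T * (\<Prod>j\<in>T. [:\<xi> ^ j:]) * (\<Prod>j\<in>?Q - T. monom 1 1))"
    by (rule prod_diff_conv_sum) simp
  also have "\<dots> = (\<Sum>T\<in>Pow ?Q. monom ((-1) ^ card T * \<xi> ^ \<Sum>T) (card ?Q - card T))"
  proof (rule sum.cong[OF refl])
    fix T assume "T \<in> Pow ?Q"
    then have T: "T \<subseteq> ?Q" "finite T" by (auto intro: finite_subset)
    have "(\<Prod>j\<in>T. [:\<xi> ^ j:]) = [:\<xi> ^ \<Sum>T:]"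
      using T(2) by (induction T) (auto simp: power_add)
    moreover have "(-1) ^ c = [:(-1) ^ c :: 'k:]" for c
      by (induction c) (auto simp: one_pCons)
    ultimately show "(-1) ^ card T * (\<Prod>j\<in>T. [:\<xi> ^ j:]) * (\<Prod>j\<in>?Q - T. monom 1 1)
        = monom ((-1) ^ card T * \<xi> ^ \<Sum>T) (card ?Q - card T)"
      using T by (simp add: card_Diff_subset monom_power smult_monom)
  qed
  finally show ?thesis
    by (simp add: coeff_sum Pow_def sum.inter_filter[symmetric] conj_commute)
qed

end

section \<open>MDS codes from systematic bases\<close>

text \<open>Submodules in terms of plain vectors, which keeps the carrier structures behind
  \<open>code_span\<close> out of the coding arguments.\<close>

definition linear_code :: "nat \<Rightarrow> 'a :: comm_ring_1 vec set \<Rightarrow> bool" where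
  "linear_code m W \<longleftrightarrow> W \<subseteq> carrier_vec m \<and> 0\<^sub>v m \<in> W \<and>
     (\<forall>v\<in>W. \<forall>w\<in>W. v + w \<in> W) \<and> (\<forall>a. \<forall>v\<in>W. a \<cdot>\<^sub>v v \<in> W)"

lemma linear_code_span:
  fixes S :: "'a :: comm_ring_1 vec set"
  assumes S: "S \<subseteq> carrier_vec m"
  shows "linear_code m (code_span m S)" and "S \<subseteq> code_span m S"
proof -
  interpret vec_module "TYPE('a)" m .
  have sub: "submodule (class_ring :: 'a ring) (span S) V" using S by (rule span_is_submodule)
  show "linear_code m (code_span m S)"
    using submodule.m_closed[OF sub] submodule.subset[OF sub] submodule.zero_closed[OF sub]
      submodule.smult_closed[OF sub]
    unfolding linear_code_def code_span_def by (simp add: module_vec_simps)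
  show "S \<subseteq> code_span m S"
    using in_own_span[OF S] unfolding code_span_def .
qed

lemma code_span_least:
  fixes S :: "'a :: comm_ring_1 vec set"
  assumes W: "linear_code m W" and S: "S \<subseteq> W"
  shows "code_span m S \<subseteq> W"
proof -
  interpret vec_module "TYPE('a)" m .
  show ?thesis
  proof
    fix v assume "v \<in> code_span m S"
    then obtain a A where v: "v = lincomb a A" and A: "finite A" "A \<subseteq> S"
      unfolding code_span_def span_def by auto
    have "lincomb a A \<in> W"
      using A
    proof (induction A rule: finite_induct)
      case (insert x A)
      have "insert x A \<subseteq> carrier_vec m" using insert.prems S W by (auto simp: linear_code_def)
      then have "lincomb a (insert x A) = a x \<cdot>\<^sub>v x + lincomb a A"
        using insert.hyps unfolding lincomb_def by (subst finsum_insert) auto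
      then show ?case using insert S W by (auto simp: linear_code_def)
    qed (use W in \<open>simp add: lincomb_def linear_code_def\<close>)
    then show "v \<in> W" by (simp add: v)
  qed
qed

lemma linear_code_sum:
  assumes W: "linear_code m W" and fin: "finite I" and w: "\<And>i. i \<in> I \<Longrightarrow> w i \<in> W"
  shows "vec m (\<lambda>j. \<Sum>i\<in>I. a i * w i $ j) \<in> W"
  using fin w
proof (induction I rule: finite_induct)
  case empty
  have "vec m (\<lambda>j. \<Sum>i\<in>{}. a i * w i $ j) = 0\<^sub>v m" by auto
  then show ?case using W by (simp add: linear_code_def)
next
  case (insert x I)
  have "w x \<in> carrier_vec m" using insert.prems W by (auto simp: linear_code_def)
  then have "vec m (\<lambda>j. \<Sum>i\<in>insert x I. a i * w i $ j)
      = a x \<cdot>\<^sub>v w x + vec m (\<lambda>j. \<Sum>i\<in>I. a i * w i $ j)"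
    using insert.hyps by auto
  then show ?case using insert W by (auto simp: linear_code_def)
qed

text \<open>The index \<open>i0\<close> marks a coordinate that may be nonzero. The choice
  \<open>i0 = k\<close> grants no exception among the first \<open>k\<close>, while
  \<open>i0 = 0\<close> fits the first systematic basis vector.\<close>

lemma hamming_weight_le:
  assumes v: "v \<in> carrier_vec m" and \<pi>: "\<pi> permutes {..<m}" and km: "k \<le> m"
    and zero: "\<And>i. i < k \<Longrightarrow> i \<noteq> i0 \<Longrightarrow> v $ \<pi> i = 0"
  shows "hamming_weight v \<le> card ({..<m} - ({..<k} - {i0}))"
proof -
  have "{i. i < dim_vec v \<and> v $ i \<noteq> 0} \<subseteq> \<pi> ` ({..<m} - ({..<k} - {i0}))"
  proof
    fix j assume "j \<in> {i. i < dim_vec v \<and> v $ i \<noteq> 0}"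
    then have j: "j < m" "v $ j \<noteq> 0" using v by auto
    then obtain i where i: "i < m" "j = \<pi> i"
      using permutes_image[OF \<pi>] by (metis imageE lessThan_iff)
    then show "j \<in> \<pi> ` ({..<m} - ({..<k} - {i0}))" using j zero[of i] by auto
  qed
  then have "hamming_weight v \<le> card (\<pi> ` ({..<m} - ({..<k} - {i0})))"
    unfolding hamming_weight_def by (intro card_mono) auto
  also have "\<dots> \<le> card ({..<m} - ({..<k} - {i0}))" by (rule card_image_le) simp
  finally show ?thesis .
qed

lemma linear_code_permute:
  assumes W: "linear_code m W" and \<pi>: "\<pi> permutes {..<m}"
  shows "linear_code m (permute_coords \<pi> ` W)"
proof -
  have lt: "\<pi> j < m" if "j < m" for j using permutes_in_image[OF \<pi>, of j] that by simp
  have carr: "v \<in> carrier_vec m" if "v \<in> W" for v using that W by (auto simp: linear_code_def)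
  have add: "permute_coords \<pi> v + permute_coords \<pi> w = permute_coords \<pi> (v + w)"
    if "v \<in> W" "w \<in> W" for v w
    using carr[OF that(1)] carr[OF that(2)] lt by (auto simp: permute_coords_def)
  have smult: "a \<cdot>\<^sub>v permute_coords \<pi> v = permute_coords \<pi> (a \<cdot>\<^sub>v v)" if "v \<in> W" for a v
    using carr[OF that] lt by (auto simp: permute_coords_def)
  have zero: "0\<^sub>v m = permute_coords \<pi> (0\<^sub>v m :: 'a vec)"
    using lt by (auto simp: permute_coords_def)
  show ?thesis unfolding linear_code_def
  proof (intro conjI ballI allI)
    show "permute_coords \<pi> ` W \<subseteq> carrier_vec m" using carr by (auto simp: permute_coords_def)
    show "0\<^sub>v m \<in> permute_coords \<pi> ` W"
      by (subst zero, rule imageI) (use W in \<open>simp add: linear_code_def\<close>)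
    show "x + y \<in> permute_coords \<pi> ` W"
      if x: "x \<in> permute_coords \<pi> ` W" and y: "y \<in> permute_coords \<pi> ` W" for x y
    proof -
      obtain v w where "v \<in> W" "w \<in> W" "x = permute_coords \<pi> v" "y = permute_coords \<pi> w"
        using x y by blast
      moreover from this have "v + w \<in> W" using W by (simp add: linear_code_def)
      ultimately show ?thesis by (simp only: add imageI)
    qed
    show "a \<cdot>\<^sub>v x \<in> permute_coords \<pi> ` W" if x: "x \<in> permute_coords \<pi> ` W" for a x
    proof -
      obtain v where "v \<in> W" "x = permute_coords \<pi> v" using x by blast
      moreover from this have "a \<cdot>\<^sub>v v \<in> W" using W by (simp add: linear_code_def)
      ultimately show ?thesis by (simp only: smult imageI)
    qed
  qed
qed

text \<open>By the weight bound, a word that vanishes on the \<open>k\<close> systematic coordinates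
  is zero, so the words \<open>w i\<close> generate \<open>W\<close>. The word \<open>w 0\<close>
  vanishes on \<open>k - 1\<close> of these coordinates and attains the bound.\<close>

lemma MDS_of_systematic_basis:
  fixes W :: "'a :: comm_ring_1 vec set"
  assumes W: "linear_code m W" and k: "1 \<le> k" "k \<le> m" and \<pi>: "\<pi> permutes {..<m}"
    and w: "\<And>i. i < k \<Longrightarrow> w i \<in> W"
    and w_unit: "\<And>i j. i < k \<Longrightarrow> j < k \<Longrightarrow> w i $ \<pi> j = (if i = j then 1 else 0)"
    and weight: "\<And>v. v \<in> W \<Longrightarrow> v \<noteq> 0\<^sub>v m \<Longrightarrow> m - k + 1 \<le> hamming_weight v"
  shows "min_distance W = m - k + 1" and "is_MDS m k W"
proof -
  have carr: "v \<in> carrier_vec m" if "v \<in> W" for v using that W by (auto simp: linear_code_def)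
  have lt: "\<pi> j < m" if "j < m" for j using permutes_in_image[OF \<pi>, of j] that by simp
  have inj: "v = 0\<^sub>v m" if v: "v \<in> W" and zero: "\<And>i. i < k \<Longrightarrow> v $ \<pi> i = 0" for v
  proof (rule ccontr)
    assume "v \<noteq> 0\<^sub>v m"
    then have "m - k + 1 \<le> hamming_weight v" using weight v by blast
    also have "\<dots> \<le> card ({..<m} - ({..<k} - {k}))"
      by (rule hamming_weight_le[OF carr[OF v] \<pi> k(2)]) (use zero in auto)
    also have "\<dots> = m - k" using k by (simp add: card_Diff_subset)
    finally show False by simp
  qed
  show dist: "min_distance W = m - k + 1"
    unfolding min_distance_def
  proof (rule Least_equality)
    have w0: "w 0 \<in> W" "w 0 \<noteq> 0\<^sub>v m"
      using w[of 0] w_unit[of 0 0] lt[of 0] k by auto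
    have "hamming_weight (w 0) \<le> card ({..<m} - ({..<k} - {0}))"
      by (rule hamming_weight_le[OF carr[OF w0(1)] \<pi> k(2)]) (use w_unit[of 0] k in auto)
    also have "\<dots> = m - k + 1" using k by (subst card_Diff_subset) auto
    finally have "hamming_weight (w 0) = m - k + 1" using weight[OF w0] by simp
    then show "\<exists>v\<in>W. v \<noteq> 0\<^sub>v (dim_vec v) \<and> hamming_weight v = m - k + 1"
      using w0 carr[OF w0(1)] by (intro bexI[of _ "w 0"]) auto
  next
    fix d assume "\<exists>v\<in>W. v \<noteq> 0\<^sub>v (dim_vec v) \<and> hamming_weight v = d"
    then show "m - k + 1 \<le> d" using weight carr by force
  qed
  define A where "A = mat k (m - k) (\<lambda>(i, j). w i $ \<pi> (k + j))"
  define G where "G = mat_of_cols k (cols (1\<^sub>m k) @ cols A)"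
  have G: "G \<in> carrier_mat k m" using k by (simp add: G_def A_def mat_of_cols_def)
  have row_G: "row G i = permute_coords \<pi> (w i)" if i: "i < k" for i
  proof (rule eq_vecI)
    fix j assume "j < dim_vec (permute_coords \<pi> (w i))"
    then have j: "j < m" using carr[OF w[OF i]] by (simp add: permute_coords_def)
    have "row G i $ j = (cols (1\<^sub>m k) @ cols A) ! j $ i"
      using i j G k by (simp add: G_def A_def mat_of_cols_index)
    also have "\<dots> = w i $ \<pi> j"
      using i j k w_unit[of i j] by (auto simp: A_def nth_append)
    finally show "row G i $ j = permute_coords \<pi> (w i) $ j"
      using j carr[OF w[OF i]] by (simp add: permute_coords_def)
  qed (use G carr[OF w[OF i]] in \<open>simp add: permute_coords_def\<close>)
  have rows: "set (rows G) = (\<lambda>i. permute_coords \<pi> (w i)) ` {..<k}"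
    using G row_G by (auto simp: rows_def)
  have rows_carr: "set (rows G) \<subseteq> carrier_vec m"
    unfolding rows using carr w by (auto simp: permute_coords_def)
  have "permute_coords \<pi> ` W = code_span m (set (rows G))"
  proof
    show "code_span m (set (rows G)) \<subseteq> permute_coords \<pi> ` W"
      by (rule code_span_least[OF linear_code_permute[OF W \<pi>]]) (use w in \<open>auto simp: rows\<close>)
    show "permute_coords \<pi> ` W \<subseteq> code_span m (set (rows G))"
    proof (rule image_subsetI)
      fix v assume v: "v \<in> W"
      \<comment> \<open>\<open>u\<close> agrees with \<open>v\<close> on the systematic coordinates,
        so their difference is zero.\<close>
      define u where "u = vec m (\<lambda>j. \<Sum>i<k. v $ \<pi> i * w i $ j)"
      have u: "u \<in> W" unfolding u_def using W w by (intro linear_code_sum) auto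
      have "v + (-1) \<cdot>\<^sub>v u = 0\<^sub>v m"
      proof (rule inj)
        show "v + (-1) \<cdot>\<^sub>v u \<in> W" using W u v by (auto simp: linear_code_def)
        fix i assume i: "i < k"
        have "(\<Sum>i'<k. v $ \<pi> i' * w i' $ \<pi> i) = (\<Sum>i'<k. if i' = i then v $ \<pi> i' else 0)"
          using i by (intro sum.cong) (auto simp: w_unit)
        then show "(v + (-1) \<cdot>\<^sub>v u) $ \<pi> i = 0"
          using i k lt[of i] carr[OF v] by (simp add: u_def)
      qed
      then have v_eq: "v $ j = u $ j" if "j < m" for j
        using that carr[OF v] carr[OF u] by (auto simp: vec_eq_iff)
      have "permute_coords \<pi> v = vec m (\<lambda>j. \<Sum>i<k. v $ \<pi> i * permute_coords \<pi> (w i) $ j)"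
      proof (rule eq_vecI)
        fix j assume "j < dim_vec (vec m (\<lambda>j. \<Sum>i<k. v $ \<pi> i * permute_coords \<pi> (w i) $ j))"
        then have j: "j < m" by simp
        then have "permute_coords \<pi> v $ j = u $ \<pi> j"
          using v_eq[OF lt[OF j]] carr[OF v] by (simp add: permute_coords_def)
        also have "\<dots> = (\<Sum>i<k. v $ \<pi> i * permute_coords \<pi> (w i) $ j)"
          using lt[OF j] j carrier_vecD[OF carr[OF w]] by (simp add: u_def permute_coords_def)
        finally show "permute_coords \<pi> v $ j
            = vec m (\<lambda>j. \<Sum>i<k. v $ \<pi> i * permute_coords \<pi> (w i) $ j) $ j"
          using j by simp
      qed (use carr[OF v] in \<open>simp add: permute_coords_def\<close>)
      also have "\<dots> \<in> code_span m (set (rows G))"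
        using linear_code_span[OF rows_carr] by (intro linear_code_sum) (auto simp: rows)
      finally show "permute_coords \<pi> v \<in> code_span m (set (rows G))" .
    qed
  qed
  moreover have "A \<in> carrier_mat k (m - k)" by (simp add: A_def)
  ultimately have "has_standard_generator m k W"
    unfolding has_standard_generator_def G_def using k \<pi> carr by blast
  then show "is_MDS m k W" using k dist by (simp add: is_MDS_def)
qed

section \<open>Extended quadratic residue codes\<close>

text \<open>Pseudo-division multiplies \<open>p\<close> by a power of the leading coefficient, here
  \<open>1\<close>. Positive degree of \<open>g\<close> covers the case
  \<open>r = 0\<close>.\<close>

lemma monic_division:
  fixes g p :: "'a :: idom poly"
  assumes "lead_coeff g = 1" "0 < degree g"
  obtains q r where "p = g * q + r" "degree r < degree g"
proof -
  have nz: "g \<noteq> 0" using assms by auto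
  obtain q r where qr: "pseudo_divmod p g = (q, r)" by (cases "pseudo_divmod p g")
  have "p = g * q + r" using pseudo_divmod(1)[OF nz qr] assms by simp
  moreover have "degree r < degree g" using pseudo_divmod(2)[OF nz qr] assms by auto
  ultimately show ?thesis by (rule that)
qed

text \<open>\<open>\<iota>\<close> embeds the coefficient ring into a field containing
  \<open>\<xi>\<close>. The element \<open>\<alpha>\<close> stands for \<open>(s - 1) / 2\<close>,
  and the idempotent enters only through its values at the powers of \<open>\<xi>\<close>.\<close>

locale qr_code = qr_root n \<xi> + \<iota>: inj_comm_ring_hom \<iota>
  for n :: nat and \<xi> :: "'k :: field_char_0" and \<iota> :: "'r :: idom \<Rightarrow> 'k" +
  fixes \<alpha> t :: 'r and e :: "'r poly"
  assumes iota_alpha: "\<iota> \<alpha> = (\<Sum>j\<in>quad_residues n. \<xi> ^ j)"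
    and t_nz: "t \<noteq> 0"
    and e_eval: "poly (map_poly \<iota> e) (\<xi> ^ j) = (if n dvd j then 1 else if \<chi> j = 1 then 0 else 1)"
begin

text \<open>The discrete Fourier transform of the first \<open>n\<close> coordinates; the extension
  coordinate has index \<open>n\<close> and stays out.\<close>

definition ev :: "'r vec \<Rightarrow> nat \<Rightarrow> 'k" where
  "ev v j = (\<Sum>i<n. \<iota> (v $ i) * \<xi> ^ (i * j))"

text \<open>The description of \<open>D\<close> by zeros, matched with the span in
  \<open>code_span_eq_W\<close>.\<close>

definition W :: "'r vec set" where
  "W = {v \<in> carrier_vec (n + 1). (\<forall>j\<in>quad_residues n. ev v j = 0) \<and> v $ n = t * (\<Sum>i<n. v $ i)}"

lemma ev_0: "ev v 0 = \<iota> (\<Sum>i<n. v $ i)"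
  by (simp add: ev_def \<iota>.hom_sum)

lemma ev_poly:
  assumes "degree P < n" and "\<And>i. i < n \<Longrightarrow> v $ i = coeff P i"
  shows "ev v j = poly (map_poly \<iota> P) (\<xi> ^ j)"
proof -
  have "poly (map_poly \<iota> P) (\<xi> ^ j) = (\<Sum>i\<le>degree P. \<iota> (coeff P i) * \<xi> ^ (i * j))"
    by (simp add: poly_altdef degree_map_poly coeff_map_poly power_mult[symmetric] mult.commute)
  also have "\<dots> = (\<Sum>i<n. \<iota> (coeff P i) * \<xi> ^ (i * j))"
    by (rule sum.mono_neutral_left) (use assms(1) in \<open>auto simp: coeff_eq_0\<close>)
  finally show ?thesis by (simp add: ev_def assms(2))
qed

text \<open>Reduction modulo \<open>X ^ n - 1\<close> preserves values at \<open>n\<close>-th roots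
  of unity.\<close>

lemma ev_cyclic_coeffs: "ev (cyclic_coeffs n p) j = poly (map_poly \<iota> p) (\<xi> ^ j)"
proof -
  interpret \<phi>: comm_ring_hom "\<lambda>P. poly (map_poly \<iota> P) (\<xi> ^ j)"
    by (rule eval_poly_hom) unfold_locales
  have "monom 1 n - 1 dvd p - (\<Sum>i<n. monom (cyclic_coeffs n p $ i) i)"
    using n_gt_2 by (intro cyclic_coeffs_correct) simp
  then obtain q where "p = (\<Sum>i<n. monom (cyclic_coeffs n p $ i) i) + (monom 1 n - 1) * q"
    by (auto simp: dvd_def algebra_simps)
  then have "poly (map_poly \<iota> p) (\<xi> ^ j)
      = poly (map_poly \<iota> ((\<Sum>i<n. monom (cyclic_coeffs n p $ i) i) + (monom 1 n - 1) * q)) (\<xi> ^ j)"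
    by (rule arg_cong)
  also have "\<dots> = (\<Sum>i<n. poly (map_poly \<iota> (monom (cyclic_coeffs n p $ i) i)) (\<xi> ^ j))
      + (poly (map_poly \<iota> (monom 1 n)) (\<xi> ^ j) - 1) * poly (map_poly \<iota> q) (\<xi> ^ j)"
    by (simp only: \<phi>.hom_add \<phi>.hom_mult \<phi>.hom_sum \<phi>.hom_minus \<phi>.hom_one)
  also have "poly (map_poly \<iota> (monom 1 n)) (\<xi> ^ j) = 1"
    using xi_n by (simp add: map_poly_monom poly_monom power_mult[symmetric] mult.commute[of j])
      (simp add: power_mult)
  finally show ?thesis
    by (simp add: ev_def map_poly_monom poly_monom power_mult[symmetric] mult.commute)
qed

lemma vanishing:
  assumes J: "J \<subseteq> {..<n}" and zero: "\<And>j. j \<in> J \<Longrightarrow> ev v j = 0"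
    and card: "card {i. i < n \<and> v $ i \<noteq> 0} \<le> card J" and m: "m < n"
  shows "v $ m = 0"
proof -
  have "odd n" using n_mod_4 by presburger
  have "\<iota> (v $ m) = 0"
    by (rule uncertainty_principle[OF prime_n \<open>odd n\<close> xi_n xi_prim J])
      (use zero card m in \<open>auto simp: ev_def\<close>)
  then show ?thesis by simp
qed

lemma ev_add: "v \<in> carrier_vec (n + 1) \<Longrightarrow> w \<in> carrier_vec (n + 1) \<Longrightarrow> ev (v + w) j = ev v j + ev w j"
  by (simp add: ev_def \<iota>.hom_add distrib_right sum.distrib)

lemma ev_smult: "v \<in> carrier_vec (n + 1) \<Longrightarrow> ev (a \<cdot>\<^sub>v v) j = \<iota> a * ev v j"
  by (simp add: ev_def \<iota>.hom_mult sum_distrib_left mult.assoc)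

lemma linear_code_W: "linear_code (n + 1) W"
  unfolding linear_code_def
proof (intro conjI ballI allI)
  show "W \<subseteq> carrier_vec (n + 1)" by (auto simp: W_def)
  show "0\<^sub>v (n + 1) \<in> W" by (simp add: W_def ev_def)
  show "v + w \<in> W" if "v \<in> W" "w \<in> W" for v w
    using that by (auto simp: W_def ev_add sum.distrib distrib_left)
  show "a \<cdot>\<^sub>v v \<in> W" if "v \<in> W" for a v
    using that by (auto simp: W_def ev_smult sum_distrib_left mult.left_commute)
qed

lemma weight_W:
  assumes v: "v \<in> W" and nz: "v \<noteq> 0\<^sub>v (n + 1)"
  shows "(n + 3) div 2 \<le> hamming_weight v"
proof -
  let ?I = "{i. i < n \<and> v $ i \<noteq> 0}"
  have carr: "v \<in> carrier_vec (n + 1)" and Q: "\<And>j. j \<in> quad_residues n \<Longrightarrow> ev v j = 0"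
    and vn: "v $ n = t * (\<Sum>i<n. v $ i)"
    using v by (auto simp: W_def)
  have "\<not> (\<forall>i<n. v $ i = 0)"
  proof
    assume "\<forall>i<n. v $ i = 0"
    moreover from this have "v $ n = 0" using vn by simp
    ultimately have "v = 0\<^sub>v (n + 1)" using carr by (intro eq_vecI) (auto simp: less_Suc_eq)
    then show False using nz by simp
  qed
  \<comment> \<open>Contrapositive of \<open>vanishing\<close>: the first \<open>n\<close>
    coordinates have more nonzero entries than the transform has known zeros.\<close>
  then have big: "card J < card ?I" if "J \<subseteq> {..<n}" "\<And>j. j \<in> J \<Longrightarrow> ev v j = 0" for J
    using vanishing[OF that] by (meson not_le)
  have Qn: "quad_residues n \<subseteq> {..<n}" by (auto simp: mem_Q_iff)
  show ?thesis
  proof (cases "v $ n = 0")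
    case True
    then have "ev v 0 = 0" using vn t_nz by (simp add: ev_0)
    then have "card (insert 0 (quad_residues n)) < card ?I"
      using Q Qn n_gt_2 by (intro big) auto
    also have "card ?I \<le> hamming_weight v"
      unfolding hamming_weight_def using carr by (intro card_mono) auto
    finally show ?thesis using zero_notin n_mod_4 by (simp add: card_Q)
  next
    case False
    have "card (quad_residues n) < card ?I" using Q Qn by (intro big) auto
    also have "card ?I + 1 = card (insert n ?I)" by simp
    also have "card (insert n ?I) \<le> hamming_weight v"
      unfolding hamming_weight_def using carr False by (intro card_mono) auto
    finally show ?thesis using n_mod_4 by (simp add: card_Q)
  qed
qed

text \<open>For a word of \<open>W\<close>, multiplication by the idempotent changes nothing: its
  transform is already \<open>0\<close> wherever that of \<open>e\<close> is \<open>0\<close>, and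
  elsewhere that of \<open>e\<close> is \<open>1\<close>.\<close>

lemma code_span_eq_W:
  "code_span (n + 1) ((\<lambda>i. cyclic_coeffs n (monom 1 i * e) @\<^sub>v vec 1 (\<lambda>_. t)) ` {0..<n}) = W"
proof -
  interpret ev_hom: comm_ring_hom "\<lambda>P. poly (map_poly \<iota> P) (\<xi> ^ j)" for j
    by (rule eval_poly_hom) unfold_locales
  define w where "w i = cyclic_coeffs n (monom 1 i * e) @\<^sub>v vec 1 (\<lambda>_. t)" for i
  have w_carr: "w i \<in> carrier_vec (n + 1)" for i
    unfolding w_def by (intro append_carrier_vec) (simp_all add: cyclic_coeffs_def carrier_vecI)
  have ev_w: "ev (w i) j = \<xi> ^ (i * j) * poly (map_poly \<iota> e) (\<xi> ^ j)" for i j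
  proof -
    have "ev (w i) j = ev (cyclic_coeffs n (monom 1 i * e)) j"
      by (simp add: ev_def w_def cyclic_coeffs_def)
    also have "\<dots> = \<xi> ^ (i * j) * poly (map_poly \<iota> e) (\<xi> ^ j)"
      unfolding ev_cyclic_coeffs ev_hom.hom_mult
      by (simp add: map_poly_monom poly_monom power_mult[symmetric] mult.commute)
    finally show ?thesis .
  qed
  have w_W: "w i \<in> W" for i
  proof -
    \<comment> \<open>Since \<open>e\<close> takes the value \<open>1\<close> at \<open>1\<close>,
      each generator has coordinate sum \<open>1\<close>, which matches its last coordinate
      \<open>t\<close>.\<close>
    have "\<iota> (\<Sum>j<n. w i $ j) = 1" unfolding ev_0[symmetric] ev_w using e_eval[of 0] by simp
    then have "(\<Sum>j<n. w i $ j) = 1" by simp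
    moreover have "w i $ n = t" by (simp add: w_def cyclic_coeffs_def)
    moreover have "ev (w i) j = 0" if "j \<in> quad_residues n" for j
    proof -
      have "\<chi> j = 1" "\<not> n dvd j" using that chi_eq_0_iff[of j] by (auto simp: mem_Q_iff)
      then show ?thesis by (simp add: ev_w e_eval)
    qed
    ultimately show ?thesis using w_carr by (simp add: W_def)
  qed
  have S: "w ` {0..<n} \<subseteq> carrier_vec (n + 1)" using w_carr by auto
  have "code_span (n + 1) (w ` {0..<n}) = W"
  proof
    show "code_span (n + 1) (w ` {0..<n}) \<subseteq> W"
      by (rule code_span_least[OF linear_code_W]) (use w_W in auto)
    show "W \<subseteq> code_span (n + 1) (w ` {0..<n})"
    proof
      fix v assume v: "v \<in> W"
      \<comment> \<open>The first \<open>n\<close> coordinates of \<open>u\<close> are the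
        coefficients of \<open>v(X) * e(X)\<close> modulo \<open>X ^ n - 1\<close>; this is why
        \<open>v\<close> itself supplies the scalars.\<close>
      define u where "u = vec (n + 1) (\<lambda>j. \<Sum>i\<in>{0..<n}. v $ i * w i $ j)"
      have carr: "v \<in> carrier_vec (n + 1)" "u \<in> carrier_vec (n + 1)"
        using v by (auto simp: W_def u_def)
      have u_W: "u \<in> W" unfolding u_def using w_W by (intro linear_code_sum[OF linear_code_W]) auto
      define d where "d = v + (-1) \<cdot>\<^sub>v u"
      have d_W: "d \<in> W" using linear_code_W v u_W by (simp add: linear_code_def d_def)
      have ev_u: "ev u j = ev v j * poly (map_poly \<iota> e) (\<xi> ^ j)" for j
      proof -
        have "ev u j = (\<Sum>m<n. \<Sum>i<n. \<iota> (v $ i) * (\<iota> (w i $ m) * \<xi> ^ (m * j)))"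
          by (simp add: ev_def u_def \<iota>.hom_sum \<iota>.hom_mult sum_distrib_right mult.assoc lessThan_atLeast0)
        also have "\<dots> = (\<Sum>i<n. \<iota> (v $ i) * ev (w i) j)"
          unfolding ev_def sum_distrib_left by (rule sum.swap)
        also have "\<dots> = ev v j * poly (map_poly \<iota> e) (\<xi> ^ j)"
          by (simp add: ev_w ev_def[of v] sum_distrib_right mult.assoc)
        finally show ?thesis .
      qed
      have "ev d j = 0" for j
      proof -
        have "ev v j = 0" if "\<chi> j = 1"
        proof -
          have "j mod n \<in> quad_residues n" unfolding mem_Q_iff chi_mod using that n_gt_2 by simp
          then have "ev v (j mod n) = 0" using v by (simp add: W_def)
          moreover have "ev v (j mod n) = ev v j"
            unfolding ev_def by (simp only: mult.commute[of _ "j mod n"] mult.commute[of _ j] power_mult xi_mod)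
          ultimately show ?thesis by simp
        qed
        moreover have "ev d j = ev v j - ev u j"
          using carr by (simp add: d_def ev_add ev_smult \<iota>.hom_uminus)
        ultimately show ?thesis by (auto simp: ev_u e_eval)
      qed
      moreover have "card {i. i < n \<and> d $ i \<noteq> 0} \<le> card {..<n}" by (rule card_mono) auto
      ultimately have d0: "d $ i = 0" if "i < n" for i
        using vanishing[of "{..<n}" d i] that by simp
      then have "d $ n = 0" using d_W by (simp add: W_def)
      have "v $ i = u $ i" if "i < n + 1" for i
      proof -
        have "d $ i = 0" using that d0 \<open>d $ n = 0\<close> by (auto simp: less_Suc_eq)
        then show ?thesis using that carr by (simp add: d_def)
      qed
      then have "v = u" using carr by (intro eq_vecI) auto
      also have "u \<in> code_span (n + 1) (w ` {0..<n})"
        unfolding u_def using linear_code_span[OF S] by (intro linear_code_sum) auto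
      finally show "v \<in> code_span (n + 1) (w ` {0..<n})" .
    qed
  qed
  then show ?thesis by (simp add: w_def)
qed

section \<open>The generator polynomial and systematic codewords\<close>

text \<open>Up to sign, each coefficient is an elementary symmetric function, hence a combination of
  \<open>1\<close>, \<open>\<alpha>\<close> and \<open>- 1 - \<alpha>\<close> with natural number
  coefficients.\<close>

lemma coeff_prod_Q_in_range:
  "coeff (\<Prod>j\<in>quad_residues n. [:- (\<xi> ^ j), 1:]) d \<in> range \<iota>"
proof -
  let ?Q = "quad_residues n"
  have le: "card T \<le> card ?Q" if "T \<subseteq> ?Q" for T using that by (intro card_mono) auto
  show ?thesis
  proof (cases "d \<le> card ?Q")
    case True
    define r where "r = card ?Q - d"
    have "{T. T \<subseteq> ?Q \<and> card ?Q - card T = d} = {T. T \<subseteq> ?Q \<and> card T = r}"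
      using le True unfolding r_def by fastforce
    then have "coeff (\<Prod>j\<in>?Q. [:- (\<xi> ^ j), 1:]) d = (-1) ^ r * (\<Sum>T | T \<subseteq> ?Q \<and> card T = r. \<xi> ^ \<Sum>T)"
      by (simp add: coeff_prod_Q sum_distrib_left)
    also have "\<dots> = \<iota> ((-1) ^ r * (of_nat (subset_sum_count r 0) + of_nat (subset_sum_count r 1) * \<alpha>
        + of_nat (subset_sum_count r (n - 1)) * (- 1 - \<alpha>)))"
      unfolding elementary_symmetric_Q sum_N_eq
      by (simp add: hom_distribs iota_alpha)
    finally show ?thesis by blast
  next
    case False
    then have "{T. T \<subseteq> ?Q \<and> card ?Q - card T = d} = {}" by auto
    then have "coeff (\<Prod>j\<in>?Q. [:- (\<xi> ^ j), 1:]) d = \<iota> 0"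
      by (simp only: coeff_prod_Q sum.empty \<iota>.hom_zero)
    then show ?thesis by blast
  qed
qed

lemma generator_polynomial:
  obtains g where "lead_coeff g = 1" "degree g = (n - 1) div 2"
    "\<And>j. j \<in> quad_residues n \<Longrightarrow> poly (map_poly \<iota> g) (\<xi> ^ j) = 0"
proof -
  let ?P = "\<Prod>j\<in>quad_residues n. [:- (\<xi> ^ j), 1:]"
  have "\<forall>d. \<exists>x. coeff ?P d = \<iota> x" using coeff_prod_Q_in_range by blast
  from choice[OF this] obtain b where b: "\<forall>d. coeff ?P d = \<iota> (b d)" ..
  define g where "g = (\<Sum>d\<le>degree ?P. monom (b d) d)"
  have g_P: "map_poly \<iota> g = ?P"
  proof (rule poly_eqI)
    fix d
    have "coeff g d = (if d \<le> degree ?P then b d else 0)"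
      by (simp add: g_def coeff_sum)
    then show "coeff (map_poly \<iota> g) d = coeff ?P d"
      by (simp add: coeff_map_poly b[rule_format, symmetric] coeff_eq_0)
  qed
  have deg_P: "degree ?P = (n - 1) div 2"
    by (subst degree_prod_sum_eq) (auto simp: card_Q)
  have "degree (map_poly \<iota> g) = degree g" by (rule degree_map_poly) simp
  then have deg: "degree g = (n - 1) div 2" unfolding g_P deg_P by simp
  have "\<iota> (lead_coeff g) = coeff ?P (degree ?P)"
    unfolding g_P[symmetric] deg[folded deg_P] by (simp add: coeff_map_poly)
  also have "\<dots> = 1" by (simp only: lead_coeff_prod) simp
  finally have "lead_coeff g = 1" by simp
  moreover note deg
  moreover have "poly (map_poly \<iota> g) (\<xi> ^ j) = 0" if "j \<in> quad_residues n" for j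
    unfolding g_P poly_prod using that by (intro prod_zero) auto
  ultimately show ?thesis by (rule that)
qed

text \<open>Subtracting from \<open>X ^ (i + h)\<close> its remainder modulo \<open>g\<close> gives
  a multiple of \<open>g\<close>, which vanishes at the required powers. The remainder has degree
  below \<open>h = (n - 1) div 2\<close>, so the \<open>h + 1\<close> positions from
  \<open>h\<close> to \<open>n - 1\<close> show a unit vector.\<close>

lemma systematic_codeword:
  assumes i: "i < (n + 1) div 2"
  shows "\<exists>w\<in>W. \<forall>j<(n + 1) div 2. w $ (j + (n - 1) div 2) = (if i = j then 1 else 0)"
proof -
  interpret ev_hom: comm_ring_hom "\<lambda>P. poly (map_poly \<iota> P) (\<xi> ^ j)" for j
    by (rule eval_poly_hom) unfold_locales
  define h where "h = (n - 1) div 2"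
  have hn: "n = 2 * h + 1" "0 < h" "(n + 1) div 2 = h + 1" using n_mod_4 n_gt_2 unfolding h_def by presburger+
  obtain g where g: "lead_coeff g = 1" "degree g = h"
    "\<And>j. j \<in> quad_residues n \<Longrightarrow> poly (map_poly \<iota> g) (\<xi> ^ j) = 0"
    using generator_polynomial unfolding h_def by blast
  obtain q r where qr: "monom 1 (i + h) = g * q + r" "degree r < h"
    using monic_division[of g] g hn by metis
  define P where "P = monom 1 (i + h) - r"
  have deg: "degree P < n"
    unfolding P_def using qr(2) i hn by (intro degree_diff_less) (auto intro: le_less_trans[OF degree_monom_le])
  have coeff_P: "coeff P (j + h) = (if i = j then 1 else 0)" for j
    using qr(2) by (simp add: P_def coeff_eq_0)
  define w where "w = vec (n + 1) (\<lambda>j. if j < n then coeff P j else t * (\<Sum>j<n. coeff P j))"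
  have "ev w j = 0" if "j \<in> quad_residues n" for j
  proof -
    have "ev w j = poly (map_poly \<iota> P) (\<xi> ^ j)"
      using deg by (rule ev_poly) (simp add: w_def)
    also have "P = g * q" using qr(1) by (simp add: P_def)
    finally show ?thesis using g(3)[OF that] by (simp only: ev_hom.hom_mult mult_zero_left)
  qed
  then have "w \<in> W" by (simp add: W_def w_def)
  moreover have "w $ (j + h) = (if i = j then 1 else 0)" if "j < (n + 1) div 2" for j
    using that hn by (simp add: w_def coeff_P)
  ultimately show ?thesis unfolding h_def by blast
qed

theorem min_distance_W: "min_distance W = (n + 3) div 2"
  and is_MDS_W: "is_MDS (n + 1) ((n + 1) div 2) W"
proof -
  define k h where "k = (n + 1) div 2" and "h = (n - 1) div 2"
  define q where "q = n div 4"
  have q: "n = 4 * q + 3" using n_mod_4 div_mult_mod_eq[of n 4] unfolding q_def by linarith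
  have kh: "k + h = n" "1 \<le> k" "n + 1 - k + 1 = (n + 3) div 2"
    unfolding k_def h_def q by simp_all
  have "\<forall>i\<in>{..<k}. \<exists>w. w \<in> W \<and> (\<forall>j<k. w $ (j + h) = (if i = j then 1 else 0))"
    using systematic_codeword[folded k_def h_def] by (simp add: Bex_def)
  from bchoice[OF this] obtain w
    where w': "\<forall>i\<in>{..<k}. w i \<in> W \<and> (\<forall>j<k. w i $ (j + h) = (if i = j then 1 else 0))" ..
  then have w: "\<And>i. i < k \<Longrightarrow> w i \<in> W"
    "\<And>i j. i < k \<Longrightarrow> j < k \<Longrightarrow> w i $ (j + h) = (if i = j then 1 else 0)"
    by blast+
  \<comment> \<open>A cyclic shift by \<open>h\<close> of the first \<open>n\<close> coordinates
    brings the systematic positions \<open>h\<close> to \<open>n - 1\<close> to the front; no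
    wraparound occurs for \<open>j < k\<close>, since \<open>k + h = n\<close>. The extension
    coordinate stays fixed.\<close>
  define \<pi> where "\<pi> j = (if j < n then (j + h) mod n else j)" for j
  have "inj_on \<pi> {..<n + 1}"
  proof (rule inj_onI)
    fix a b assume ab: "a \<in> {..<n + 1}" "b \<in> {..<n + 1}" "\<pi> a = \<pi> b"
    have lt: "x mod n < n" for x using n_gt_2 by simp
    consider "a < n" "b < n" | "a = n" "b = n" | "a < n" "b = n" | "a = n" "b < n"
      using ab(1,2) by fastforce
    then show "a = b"
    proof cases
      case 1
      then have "[a + h = b + h] (mod n)" using ab(3) by (simp add: \<pi>_def cong_def)
      then show ?thesis using 1 by (simp only: cong_add_rcancel_nat cong_less_modulus_unique_nat)
    next
      case 3
      then show ?thesis using ab(3) lt[of "a + h"] by (simp add: \<pi>_def)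
    next
      case 4
      then show ?thesis using ab(3) lt[of "b + h"] by (simp add: \<pi>_def)
    qed simp
  qed
  moreover have "\<pi> ` {..<n + 1} \<subseteq> {..<n + 1}"
    using n_gt_2 by (auto simp: \<pi>_def less_Suc_eq)
  ultimately have "bij_betw \<pi> {..<n + 1} {..<n + 1}" by (simp add: bij_betw_def endo_inj_surj)
  then have \<pi>: "\<pi> permutes {..<n + 1}" by (rule bij_imp_permutes) (simp add: \<pi>_def)
  have w_unit: "w i $ \<pi> j = (if i = j then 1 else 0)" if "i < k" "j < k" for i j
    using w(2)[OF that] that kh(1,2) by (simp add: \<pi>_def)
  have weight: "n + 1 - k + 1 \<le> hamming_weight v" if "v \<in> W" "v \<noteq> 0\<^sub>v (n + 1)" for v
    unfolding kh(3) using that by (rule weight_W)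
  have "k \<le> n + 1" using kh(1) by simp
  note MDS = MDS_of_systematic_basis[OF linear_code_W kh(2) this \<pi> w(1) w_unit weight]
  show "min_distance W = (n + 3) div 2"
    unfolding kh(3)[symmetric] by (rule MDS(1))
  show "is_MDS (n + 1) ((n + 1) div 2) W"
    unfolding k_def[symmetric] by (rule MDS(2))
qed

end

section \<open>Specialisation to the 2-adic integers\<close>

text \<open>This gives \<open>q2adic\<close> characteristic \<open>0\<close>, which passes to its
  algebraic closure, where \<open>\<xi>\<close> lives.\<close>

instance fract :: ("{idom, ring_char_0}") field_char_0
proof
  have "of_nat m = to_fract (of_nat m :: 'a)" for m by (induction m) simp_all
  then show "inj (of_nat :: nat \<Rightarrow> 'a fract)" by (simp add: inj_def)
qed

theorem theorem8:
  fixes n :: nat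
    and \<xi> :: "q2adic alg_closure"
    and s t :: z2adic
    and e1 :: "z2adic poly"
    and D :: "z2adic vec set"
  assumes "Factorial_Ring.prime n" and "n mod 8 = 7"
    and "\<xi> ^ n = 1" and "\<And>j. 0 < j \<Longrightarrow> j < n \<Longrightarrow> \<xi> ^ j \<noteq> 1"
    and "to_ac (to_fract s) = 1 + 2 * (\<Sum>j\<in>quad_residues n. \<xi> ^ j)"
    and "map_poly to_fract e1 =
           [: (of_nat n + 1) / (2 * of_nat n) :]
           + Polynomial.smult ((1 + to_fract s) / (2 * of_nat n))
               (\<Sum>i\<in>quad_residues n. Polynomial.monom 1 i)
           + Polynomial.smult ((1 - to_fract s) / (2 * of_nat n))
               (\<Sum>i\<in>quad_nonresidues n. Polynomial.monom 1 i)"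
    and "(to_fract t)\<^sup>2 = - 1 / of_nat n"
    and "D = code_span (n + 1)
           ((\<lambda>i. cyclic_coeffs n (Polynomial.monom 1 i * e1) @\<^sub>v vec 1 (\<lambda>_. t)) ` {0..<n})"
  shows "min_distance D = (n + 3) div 2 \<and> is_MDS (n + 1) ((n + 1) div 2) D"
proof -
  let ?\<iota> = "\<lambda>x :: z2adic. to_ac (to_fract x)"
  let ?Q = "quad_residues n" and ?N = "quad_nonresidues n"
  have "n mod 4 = 3" using assms(2) by presburger
  interpret qr_root n \<xi>
    by unfold_locales (use assms(1,3,4) \<open>n mod 4 = 3\<close> in auto)
  have n0: "(of_nat n :: q2adic) \<noteq> 0" using n_gt_2 by simp
  have \<iota>: "inj_comm_ring_hom ?\<iota>"
    by unfold_locales simp_all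
  interpret \<phi>: comm_ring_hom "\<lambda>P. poly (map_poly to_ac P) (\<xi> ^ j)" for j
    by (rule eval_poly_hom, unfold_locales) simp_all
  have smult: "poly (map_poly to_ac (Polynomial.smult a P)) (\<xi> ^ j)
      = to_ac a * poly (map_poly to_ac P) (\<xi> ^ j)" for a :: q2adic and P j
    using \<phi>.hom_mult[of "[:a:]" P j] by (simp add: map_poly_pCons)
  have e1_eval: "poly (map_poly ?\<iota> e1) (\<xi> ^ j)
      = (if n dvd j then 1 else if \<chi> j = 1 then 0 else 1)" for j
  proof -
    have "map_poly ?\<iota> e1 = map_poly to_ac (map_poly to_fract e1)"
      by (simp add: map_poly_map_poly o_def)
    then have "poly (map_poly ?\<iota> e1) (\<xi> ^ j)
      = (of_nat n + 1) / (2 * of_nat n)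
        + (1 + ?\<iota> s) / (2 * of_nat n) * (\<Sum>i\<in>?Q. \<xi> ^ (i * j))
        + (1 - ?\<iota> s) / (2 * of_nat n) * (\<Sum>i\<in>?N. \<xi> ^ (i * j))"
      unfolding assms(6)
      by (simp add: \<phi>.hom_add \<phi>.hom_sum smult map_poly_pCons map_poly_monom poly_monom
          power_mult[symmetric] mult.commute)
    then show ?thesis using idempotent_eval[of "?\<iota> s" j] assms(5) gauss_sum_1_eq by simp
  qed
  text \<open>The coefficient of \<open>X\<close> in \<open>e1\<close> shows that \<open>(1 + s) / 2\<close> is a 2-adic integer.\<close>
  have "1 \<in> ?Q" using chi_1 n_gt_2 by (simp add: mem_Q_iff)
  then have "1 \<notin> ?N" using Q_N_disjoint by blast
  have "to_fract (coeff e1 1) = coeff (map_poly to_fract e1) 1" by (simp add: coeff_map_poly)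
  also have "\<dots> = (1 + to_fract s) / (2 * of_nat n)"
    using \<open>1 \<in> ?Q\<close> \<open>1 \<notin> ?N\<close> unfolding assms(6) by (simp add: coeff_sum)
  finally have "of_nat n * to_fract (coeff e1 1) = (1 + to_fract s) / 2"
    using n0 by simp
  then have "to_ac (of_nat n * to_fract (coeff e1 1)) = to_ac ((1 + to_fract s) / 2)"
    by (rule arg_cong)
  then have c: "of_nat n * ?\<iota> (coeff e1 1) = (1 + ?\<iota> s) / 2" by simp
  interpret \<iota>: inj_comm_ring_hom ?\<iota> by (rule \<iota>)
  \<comment> \<open>Subtracting \<open>1\<close> from \<open>(1 + s) / 2\<close> leaves
    \<open>(s - 1) / 2\<close>, the sum of the residue powers of \<open>\<xi>\<close>; this is the
    witness for \<open>\<alpha>\<close>.\<close>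
  have "?\<iota> (of_nat n * coeff e1 1 - 1) = (1 + ?\<iota> s) / 2 - 1"
    by (simp only: \<iota>.hom_minus \<iota>.hom_mult \<iota>.hom_of_nat \<iota>.hom_one c)
  also have "\<dots> = (\<Sum>j\<in>?Q. \<xi> ^ j)" unfolding assms(5) by (simp add: field_simps)
  finally have alpha: "?\<iota> (of_nat n * coeff e1 1 - 1) = (\<Sum>j\<in>?Q. \<xi> ^ j)" .
  interpret qr_code n \<xi> ?\<iota> "of_nat n * coeff e1 1 - 1" t e1
  proof (unfold_locales, rule alpha)
    show "t \<noteq> 0" using assms(7) n0 by auto
  qed (rule e1_eval)
  show ?thesis
    unfolding assms(8) code_span_eq_W by (intro conjI min_distance_W is_MDS_W)
qed

end
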